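(* Let $\mathcal X,\mathcal Z$ be Banach spaces, $E\in\mathcal L(\mathcal X,\mathcal Z)$, $A\colon\mathcal D(A)\subseteq\mathcal X\to\mathcal Z$ closed, linear and densely defined, with $\rho(E,A)\neq\emptyset$. (a) If the nilpotency index $p_{\rm nilp}^{(E,A)}$ and the perturbation index $p_{\rm pert}^{(E,A)}$ exist, then $p_{\rm nilp}^{(E,A)}\le p_{\rm pert}^{(E,A)}$. (b) If the nilpotency index $p_{\rm nilp}^{(E,A)}$ exists and the operator $A_1$ in the Weierstraß form generates a $C_0$-semigroup, then the perturbation index also exists and $p_{\rm nilp}^{(E,A)}=p_{\rm pert}^{(E,A)}$.
   Context: $\rho(E,A)$ is the set of $\lambda\in\mathbb C$ for which $\lambda E-A\colon\mathcal D(A)\to\mathcal Z$ has an inverse $(\lambda E-A)^{-1}\in\mathcal L(\mathcal Z,\mathcal X)$. Perturbation index: consider $\frac{d}{dt}Ex(t)=Ax(t)+\delta(t)$ on $[0,T]$. A solution is a classical solution: $x$ takes values in $\mathcal D(A)$, $Ex(\cdot)$ is continuously differentiable with values in $\mathcal Z$, and the equation holds for every $t$. The perturbation index is the smallest $p\in\mathbb N_0$ such that there is $c>0$ such that all solutions $x$ with $\delta\in C^{p-1}([0,T],\mathcal Z)$ (continuous $\delta$ if $p=0$) satisfy $\max_{0\le t\le T}\|x(t)\|_{\mathcal X}\le c\big(\|x(0)\|_{\mathcal X}+\sum_{i=0}^{p-1}\max_{0\le t\le T}\|\frac{d^i}{dt^i}\delta(t)\|_{\mathcal Z}\big)$ if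 $p>0$, and $\max_{0\le t\le T}\|x(t)\|_{\mathcal X}\le c\big(\|x(0)\|_{\mathcal X}+\int_0^T\|\delta(t)\|_{\mathcal Z}\,dt\big)$ if $p=0$. Equivalence: $(E,A)\sim(\tilde E,\tilde A)$ (with $\tilde E\in\mathcal L(\tilde{\mathcal X},\tilde{\mathcal Z})$, $\tilde A$ from $\tilde{\mathcal X}$ to $\tilde{\mathcal Z}$) if there are bounded isomorphisms $P\colon\mathcal X\to\tilde{\mathcal X}$, $Q\colon\mathcal Z\to\tilde{\mathcal Z}$ with $E=Q^{-1}\tilde EP$, $A=Q^{-1}\tilde AP$. Weierstraß form: $(E,A)$ has a Weierstraß form if there is a Hilbert space $\mathcal Y=\mathcal Y^1\oplus\mathcal Y^2$ with $(E,A)\sim\left(\begin{bmatrix}I_{\mathcal Y^1}&0\\0&N\end{bmatrix},\begin{bmatrix}A_1&0\\0&I_{\mathcal Y^2}\end{bmatrix}\right)$, where $N\in\mathcal L(\mathcal Y^2)$ is nilpotent and $A_1\colon\mathcal D(A_1)\subseteq\mathcal Y^1\to\mathcal Y^1$ is linear. The degree of nilpotency of $N$ is the number $p$ with $N^p=0$ and $N^l\ne0$ for $l<p$. Nilpotency index: defined if $(E,A)$ has a Weierstraß form; it is the degree of nilpotency of $N$, and $0$ if $N$ is absent (i.e. $(E,A)\sim(I_{\mathcal Y^1},A_1)$). *)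

theory Defs
  imports "HOL-Analysis.Analysis"
begin

section \<open>Complex Banach and Hilbert spaces\<close>

class scaleC = scaleR +
  fixes scaleC :: "complex \<Rightarrow> 'a \<Rightarrow> 'a" (infixr "*\<^sub>C" 75)
  assumes scaleR_scaleC: "r *\<^sub>R x = complex_of_real r *\<^sub>C x"

class complex_vector = scaleC + ab_group_add +
  assumes scaleC_add_right: "a *\<^sub>C (x + y) = a *\<^sub>C x + a *\<^sub>C y"
    and scaleC_add_left: "(a + b) *\<^sub>C x = a *\<^sub>C x + b *\<^sub>C x"
    and scaleC_scaleC: "a *\<^sub>C b *\<^sub>C x = (a * b) *\<^sub>C x"
    and scaleC_one: "1 *\<^sub>C x = x"

class complex_normed_vector = complex_vector + real_normed_vector +
  assumes norm_scaleC: "norm (a *\<^sub>C x) = cmod a * norm x"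

class cbanach = complex_normed_vector + complete_space

text \<open>\<open>cinner\<close> is linear in its first argument. Symmetry, positivity and definiteness
  follow from the last axiom and \<^const>\<open>norm\<close> being a norm.\<close>

class complex_inner = complex_normed_vector +
  fixes cinner :: "'a \<Rightarrow> 'a \<Rightarrow> complex"
  assumes cinner_commute: "cinner x y = cnj (cinner y x)"
    and cinner_add_left: "cinner (x + y) z = cinner x z + cinner y z"
    and cinner_scaleC_left: "cinner (a *\<^sub>C x) y = a * cinner x y"
    and cinner_self: "cinner x x = complex_of_real ((norm x)\<^sup>2)"

class chilbert_space = complex_inner + complete_space

subclass (in cbanach) banach ..
subclass (in chilbert_space) cbanach ..

instantiation complex :: chilbert_space
begin

definition scaleC_complex :: "complex \<Rightarrow> complex \<Rightarrow> complex"
  where "scaleC_complex a x = a * x"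

definition cinner_complex :: "complex \<Rightarrow> complex \<Rightarrow> complex"
  where "cinner_complex x y = x * cnj y"

instance
  by standard
    (simp_all add: scaleC_complex_def cinner_complex_def scaleR_conv_of_real algebra_simps
      norm_mult complex_norm_square del: of_real_power)

end

text \<open>The zero space, for Weierstrass forms in which one of the two blocks is absent.\<close>

instantiation unit :: complex_inner
begin

definition zero_unit :: unit where "zero_unit = ()"
definition plus_unit :: "unit \<Rightarrow> unit \<Rightarrow> unit" where "plus_unit x y = ()"
definition minus_unit :: "unit \<Rightarrow> unit \<Rightarrow> unit" where "minus_unit x y = ()"
definition uminus_unit :: "unit \<Rightarrow> unit" where "uminus_unit x = ()"
definition scaleR_unit :: "real \<Rightarrow> unit \<Rightarrow> unit" where "scaleR_unit r x = ()"
definition scaleC_unit :: "complex \<Rightarrow> unit \<Rightarrow> unit" where "scaleC_unit a x = ()"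
definition norm_unit :: "unit \<Rightarrow> real" where "norm_unit x = 0"
definition sgn_unit :: "unit \<Rightarrow> unit" where "sgn_unit x = ()"
definition dist_unit :: "unit \<Rightarrow> unit \<Rightarrow> real" where "dist_unit x y = 0"
definition cinner_unit :: "unit \<Rightarrow> unit \<Rightarrow> complex" where "cinner_unit x y = 0"
definition uniformity_unit :: "(unit \<times> unit) filter"
  where "uniformity_unit = (INF e\<in>{0 <..}. principal {(x, y). dist x y < e})"
definition open_unit :: "unit set \<Rightarrow> bool"
  where "open_unit U = (\<forall>x\<in>U. eventually (\<lambda>(x', y). x' = x \<longrightarrow> y \<in> U) uniformity)"

instance
  by standard
    (auto simp: norm_unit_def dist_unit_def cinner_unit_def uniformity_unit_def open_unit_def)

end

instance unit :: chilbert_space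
proof
  fix X :: "nat \<Rightarrow> unit"
  have "X = (\<lambda>_. ())"
    by auto
  then show "convergent X"
    by (simp add: convergent_const)
qed

text \<open>The norm on products is the Hilbert sum norm, so \<^typ>\<open>'a \<times> 'b\<close> is the orthogonal sum.\<close>

instantiation prod :: (complex_normed_vector, complex_normed_vector) complex_normed_vector
begin

definition scaleC_prod :: "complex \<Rightarrow> 'a \<times> 'b \<Rightarrow> 'a \<times> 'b"
  where "scaleC_prod a x = (a *\<^sub>C fst x, a *\<^sub>C snd x)"

instance
proof
  fix a b :: complex and r :: real and x y :: "'a \<times> 'b"
  show "r *\<^sub>R x = complex_of_real r *\<^sub>C x"
    by (simp add: scaleC_prod_def scaleR_prod_def scaleR_scaleC)
  show "a *\<^sub>C (x + y) = a *\<^sub>C x + a *\<^sub>C y"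
    by (simp add: scaleC_prod_def scaleC_add_right)
  show "(a + b) *\<^sub>C x = a *\<^sub>C x + b *\<^sub>C x"
    by (simp add: scaleC_prod_def scaleC_add_left)
  show "a *\<^sub>C b *\<^sub>C x = (a * b) *\<^sub>C x"
    by (simp add: scaleC_prod_def scaleC_scaleC)
  show "1 *\<^sub>C x = x"
    by (simp add: scaleC_prod_def scaleC_one)
  show "norm (a *\<^sub>C x) = cmod a * norm x"
    by (simp add: scaleC_prod_def norm_prod_def norm_scaleC power_mult_distrib
        distrib_left[symmetric] real_sqrt_mult)
qed

end

instance prod :: (cbanach, cbanach) cbanach ..

instantiation prod :: (complex_inner, complex_inner) complex_inner
begin

definition cinner_prod :: "'a \<times> 'b \<Rightarrow> 'a \<times> 'b \<Rightarrow> complex"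
  where "cinner_prod x y = cinner (fst x) (fst y) + cinner (snd x) (snd y)"

instance
proof
  fix a :: complex and x y z :: "'a \<times> 'b"
  show "cinner x y = cnj (cinner y x)"
    by (metis cinner_prod_def cinner_commute complex_cnj_add)
  show "cinner (x + y) z = cinner x z + cinner y z"
    by (simp add: cinner_prod_def cinner_add_left)
  show "cinner (a *\<^sub>C x) y = a * cinner x y"
    by (simp add: cinner_prod_def scaleC_prod_def cinner_scaleC_left distrib_left)
  show "cinner x x = complex_of_real ((norm x)\<^sup>2)"
    by (simp add: cinner_prod_def cinner_self norm_prod_def)
qed

end

instance prod :: (chilbert_space, chilbert_space) chilbert_space ..


section \<open>Operators\<close>

definition bounded_clinear :: "('a::complex_normed_vector \<Rightarrow> 'b::complex_normed_vector) \<Rightarrow> bool"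
  where "bounded_clinear f \<longleftrightarrow> bounded_linear f \<and> (\<forall>a x. f (a *\<^sub>C x) = a *\<^sub>C f x)"

text \<open>A possibly unbounded operator is a domain \<^term>\<open>D\<close> together with a total function
  \<^term>\<open>A\<close>, whose values outside \<^term>\<open>D\<close> are never used.\<close>

definition linear_operator ::
    "'a::complex_vector set \<Rightarrow> ('a \<Rightarrow> 'b::complex_vector) \<Rightarrow> bool"
  where "linear_operator D A \<longleftrightarrow>
    0 \<in> D \<and> (\<forall>x\<in>D. \<forall>y\<in>D. x + y \<in> D \<and> A (x + y) = A x + A y) \<and>
    (\<forall>a. \<forall>x\<in>D. a *\<^sub>C x \<in> D \<and> A (a *\<^sub>C x) = a *\<^sub>C A x)"

definition closed_operator ::
    "'a::topological_space set \<Rightarrow> ('a \<Rightarrow> 'b::topological_space) \<Rightarrow> bool"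
  where "closed_operator D A \<longleftrightarrow> closed ((\<lambda>x. (x, A x)) ` D)"

definition densely_defined :: "'a::topological_space set \<Rightarrow> bool"
  where "densely_defined D \<longleftrightarrow> closure D = UNIV"

definition resolvent_set ::
    "('x::complex_normed_vector \<Rightarrow> 'z::complex_normed_vector) \<Rightarrow> 'x set \<Rightarrow> ('x \<Rightarrow> 'z) \<Rightarrow> complex set"
  where "resolvent_set E D A = {l. \<exists>R. bounded_clinear R \<and>
    (\<forall>z. R z \<in> D \<and> l *\<^sub>C E (R z) - A (R z) = z) \<and>
    (\<forall>x\<in>D. R (l *\<^sub>C E x - A x) = x)}"

definition bounded_isomorphism ::
    "('a::complex_normed_vector \<Rightarrow> 'b::complex_normed_vector) \<Rightarrow> bool"
  where "bounded_isomorphism P \<longleftrightarrow> bounded_clinear P \<and> bij P \<and> bounded_clinear (inv P)"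

text \<open>The domain condition is part of the operator equation \<open>A = Q\<^sup>-\<^sup>1 A' P\<close>.\<close>

definition equivalent_pairs ::
    "('x::complex_normed_vector \<Rightarrow> 'z::complex_normed_vector) \<Rightarrow> 'x set \<Rightarrow> ('x \<Rightarrow> 'z) \<Rightarrow>
     ('u::complex_normed_vector \<Rightarrow> 'w::complex_normed_vector) \<Rightarrow> 'u set \<Rightarrow> ('u \<Rightarrow> 'w) \<Rightarrow> bool"
  where "equivalent_pairs E D A E' D' A' \<longleftrightarrow>
    (\<exists>P Q. bounded_isomorphism P \<and> bounded_isomorphism Q \<and>
      (\<forall>x. E x = inv Q (E' (P x))) \<and>
      D = {x. P x \<in> D'} \<and> (\<forall>x\<in>D. A x = inv Q (A' (P x))))"

definition nilpotency_degree :: "('a::zero \<Rightarrow> 'a) \<Rightarrow> nat \<Rightarrow> bool"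
  where "nilpotency_degree N p \<longleftrightarrow> N ^^ p = (\<lambda>_. 0) \<and> (\<forall>l<p. N ^^ l \<noteq> (\<lambda>_. 0))"


section \<open>Weierstrass form and nilpotency index\<close>

text \<open>The Hilbert space \<open>Y\<^sup>1 \<oplus> Y\<^sup>2\<close> is \<^typ>\<open>'y1 \<times> 'y2\<close>.\<close>

definition weierstrass_form ::
    "('x::complex_normed_vector \<Rightarrow> 'z::complex_normed_vector) \<Rightarrow> 'x set \<Rightarrow> ('x \<Rightarrow> 'z) \<Rightarrow>
     'y1::chilbert_space set \<Rightarrow> ('y1 \<Rightarrow> 'y1) \<Rightarrow> ('y2::chilbert_space \<Rightarrow> 'y2) \<Rightarrow> bool"
  where "weierstrass_form E D A D1 A1 N \<longleftrightarrow>
    linear_operator D1 A1 \<and> bounded_clinear N \<and> (\<exists>p. nilpotency_degree N p) \<and>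
    equivalent_pairs E D A
      (\<lambda>(y1, y2). (y1, N y2)) (D1 \<times> UNIV) (\<lambda>(y1, y2). (A1 y1, y2))"

text \<open>\<open>weierstrass_index TYPE('y2) E D A D1 A1 p\<close>: the pair has a Weierstrass form over
  \<^typ>\<open>'y1 \<times> 'y2\<close> with first block \<^term>\<open>A1\<close> and nilpotency index \<^term>\<open>p\<close>. HOL formulas cannot
  quantify over types, so the existential quantifier over the spaces turns into type
  parameters; a hypothesis on all of them is a theorem that is polymorphic in \<^typ>\<open>'y1\<close>
  and \<^typ>\<open>'y2\<close>.\<close>

definition weierstrass_index ::
    "'y2::chilbert_space itself \<Rightarrow>
     ('x::complex_normed_vector \<Rightarrow> 'z::complex_normed_vector) \<Rightarrow> 'x set \<Rightarrow> ('x \<Rightarrow> 'z) \<Rightarrow>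
     'y1::chilbert_space set \<Rightarrow> ('y1 \<Rightarrow> 'y1) \<Rightarrow> nat \<Rightarrow> bool"
  where "weierstrass_index _ E D A D1 A1 p \<longleftrightarrow>
    (\<exists>N :: 'y2 \<Rightarrow> 'y2. weierstrass_form E D A D1 A1 N \<and> nilpotency_degree N p) \<or>
    (p = 0 \<and> linear_operator D1 A1 \<and> equivalent_pairs E D A (\<lambda>y. y) D1 A1)"

definition has_nilpotency_index ::
    "'y1::chilbert_space itself \<Rightarrow> 'y2::chilbert_space itself \<Rightarrow>
     ('x::complex_normed_vector \<Rightarrow> 'z::complex_normed_vector) \<Rightarrow> 'x set \<Rightarrow> ('x \<Rightarrow> 'z) \<Rightarrow> nat \<Rightarrow> bool"
  where "has_nilpotency_index _ Y2 E D A p \<longleftrightarrow>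
    (\<exists>(D1 :: 'y1 set) A1. weierstrass_index Y2 E D A D1 A1 p)"


section \<open>Perturbation index\<close>

text \<open>Derivatives on \<open>[0,T]\<close>, one-sided at the end points.\<close>

primrec nth_deriv :: "real \<Rightarrow> nat \<Rightarrow> (real \<Rightarrow> 'a::real_normed_vector) \<Rightarrow> real \<Rightarrow> 'a"
  where
    "nth_deriv T 0 f = f"
  | "nth_deriv T (Suc i) f = (\<lambda>t. vector_derivative (nth_deriv T i f) (at t within {0..T}))"

definition C_k :: "real \<Rightarrow> nat \<Rightarrow> (real \<Rightarrow> 'a::real_normed_vector) \<Rightarrow> bool"
  where "C_k T k f \<longleftrightarrow>
    (\<forall>i<k. \<forall>t\<in>{0..T}. nth_deriv T i f differentiable (at t within {0..T})) \<and>
    continuous_on {0..T} (nth_deriv T k f)"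

definition classical_solution ::
    "real \<Rightarrow> ('x::real_normed_vector \<Rightarrow> 'z::real_normed_vector) \<Rightarrow> 'x set \<Rightarrow> ('x \<Rightarrow> 'z) \<Rightarrow>
     (real \<Rightarrow> 'z) \<Rightarrow> (real \<Rightarrow> 'x) \<Rightarrow> bool"
  where "classical_solution T E D A \<delta> x \<longleftrightarrow>
    (\<forall>t\<in>{0..T}. x t \<in> D) \<and> C_k T 1 (\<lambda>t. E (x t)) \<and>
    (\<forall>t\<in>{0..T}. ((\<lambda>s. E (x s)) has_vector_derivative A (x t) + \<delta> t) (at t within {0..T}))"

text \<open>The bound on the maximum of \<open>\<parallel>x\<parallel>\<close> is stated pointwise. The suprema on the right are
  maxima of continuous functions. For \<^term>\<open>p = 0\<close> truncated subtraction makes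
  \<^term>\<open>C_k T (p - 1)\<close> plain continuity.\<close>

definition perturbation_estimate ::
    "real \<Rightarrow> ('x::real_normed_vector \<Rightarrow> 'z::real_normed_vector) \<Rightarrow> 'x set \<Rightarrow> ('x \<Rightarrow> 'z) \<Rightarrow> nat \<Rightarrow> bool"
  where "perturbation_estimate T E D A p \<longleftrightarrow>
    (\<exists>c>0. \<forall>x \<delta>. C_k T (p - 1) \<delta> \<longrightarrow> classical_solution T E D A \<delta> x \<longrightarrow>
      (\<forall>t\<in>{0..T}. norm (x t) \<le> c * (norm (x 0) +
        (if p = 0 then integral {0..T} (\<lambda>s. norm (\<delta> s))
         else (\<Sum>i\<in>{0..p - 1}. SUP s\<in>{0..T}. norm (nth_deriv T i \<delta> s))))))"

definition has_perturbation_index ::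
    "real \<Rightarrow> ('x::real_normed_vector \<Rightarrow> 'z::real_normed_vector) \<Rightarrow> 'x set \<Rightarrow> ('x \<Rightarrow> 'z) \<Rightarrow> nat \<Rightarrow> bool"
  where "has_perturbation_index T E D A p \<longleftrightarrow>
    perturbation_estimate T E D A p \<and> (\<forall>q<p. \<not> perturbation_estimate T E D A q)"


section \<open>Strongly continuous semigroups\<close>

definition C0_semigroup :: "(real \<Rightarrow> 'a::complex_normed_vector \<Rightarrow> 'a) \<Rightarrow> bool"
  where "C0_semigroup S \<longleftrightarrow>
    (\<forall>t\<ge>0. bounded_clinear (S t)) \<and> S 0 = id \<and>
    (\<forall>s\<ge>0. \<forall>t\<ge>0. S (s + t) = S s \<circ> S t) \<and>
    (\<forall>y. ((\<lambda>t. S t y) \<longlongrightarrow> y) (at_right 0))"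

definition generates_C0_semigroup ::
    "'a::complex_normed_vector set \<Rightarrow> ('a \<Rightarrow> 'a) \<Rightarrow> bool"
  where "generates_C0_semigroup D A \<longleftrightarrow>
    (\<exists>S. C0_semigroup S \<and>
      D = {y. \<exists>z. ((\<lambda>h. (1 / h) *\<^sub>R (S h y - y)) \<longlongrightarrow> z) (at_right 0)} \<and>
      (\<forall>y\<in>D. ((\<lambda>h. (1 / h) *\<^sub>R (S h y - y)) \<longlongrightarrow> A y) (at_right 0)))"

end

theory Submission
  imports Defs
begin

text \<open>For \<open>v \<in> D\<close> the function \<open>x t = e\<^sup>l\<^sup>t v\<close> solves the equation with perturbation
  \<open>e\<^sup>l\<^sup>t (l E v - A v)\<close>, so an estimate of order \<open>q\<close> bounds the growth of \<open>(l E - A)\<^sup>-\<^sup>1\<close> as \<open>l \<rightarrow> \<infinity>\<close>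
  by a multiple of \<open>l\<^sup>q\<^sup>-\<^sup>1\<close>; on the nilpotent block of a Weierstrass form this inverse grows like
  \<open>l\<^sup>p\<^sup>-\<^sup>1\<close>, whence \<open>p \<le> q\<close>. Conversely, the block of \<open>A\<^sub>1\<close> is controlled by the variation of constants
  formula, and the nilpotent block by the explicit solution \<open>- (\<Sum>i<p. N\<^sup>i \<delta>\<^sup>(\<^sup>i\<^sup>))\<close>.\<close>

subsection \<open>Linear operators\<close>

lemma
  fixes A :: "'a::complex_vector \<Rightarrow> 'b::complex_vector"
  assumes "linear_operator D A"
  shows linear_operator_zero_mem: "0 \<in> D"
    and linear_operator_zero: "A 0 = 0"
    and linear_operator_scaleR_mem: "v \<in> D \<Longrightarrow> r *\<^sub>R v \<in> D"
    and linear_operator_scaleR: "v \<in> D \<Longrightarrow> A (r *\<^sub>R v) = r *\<^sub>R A v"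
proof -
  show zero: "0 \<in> D"
    using assms by (simp add: linear_operator_def)
  show "v \<in> D \<Longrightarrow> r *\<^sub>R v \<in> D" "v \<in> D \<Longrightarrow> A (r *\<^sub>R v) = r *\<^sub>R A v"
    using assms by (simp_all add: linear_operator_def scaleR_scaleC)
  have "A (0 + 0) = A 0 + A 0"
    using assms zero by (simp only: linear_operator_def)
  then show "A 0 = 0"
    by simp
qed

subsection \<open>Iterated derivatives on a compact interval\<close>

text \<open>For \<open>T > 0\<close> each point of \<open>{0..T}\<close>, end points included, is a
  limit point of the interval, so the derivative within it is unique.\<close>

lemma vector_derivative_within_Icc:
  assumes "T > 0" "t \<in> {0..T}" "(f has_vector_derivative f') (at t within {0..T})"
  shows "vector_derivative f (at t within {0..T}) = f'"
  using vector_derivative_within_cbox[of 0 T t f f'] assms by simp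

lemma nth_deriv_has_vector_derivative:
  assumes "C_k T k f" "i < k" "t \<in> {0..T}"
  shows "(nth_deriv T i f has_vector_derivative nth_deriv T (Suc i) f t) (at t within {0..T})"
  using assms by (simp add: C_k_def vector_derivative_works)

lemma nth_deriv_continuous_on:
  assumes "C_k T k f" "i \<le> k"
  shows "continuous_on {0..T} (nth_deriv T i f)"
proof (cases "i = k")
  case True
  then show ?thesis
    using assms by (simp add: C_k_def)
next
  case False
  then have "i < k"
    using assms by simp
  then show ?thesis
    using assms(1) by (intro differentiable_imp_continuous_on) (auto simp: C_k_def differentiable_on_def)
qed

lemma nth_deriv_bounded_linear:
  assumes "T > 0" "bounded_linear Q" "C_k T k f" "i \<le> k" "t \<in> {0..T}"
  shows "nth_deriv T i (\<lambda>s. Q (f s)) t = Q (nth_deriv T i f t)"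
  using assms(4,5)
proof (induction i arbitrary: t)
  case (Suc i)
  have "((\<lambda>s. Q (nth_deriv T i f s)) has_vector_derivative Q (nth_deriv T (Suc i) f t)) (at t within {0..T})"
    by (rule bounded_linear.has_vector_derivative[OF assms(2)
          nth_deriv_has_vector_derivative[OF assms(3)]]) (use Suc.prems in auto)
  \<comment> \<open>The induction hypothesis identifies the two functions on \<open>{0..T}\<close>
    only. This suffices because the derivative is taken within that set.\<close>
  then have "(nth_deriv T i (\<lambda>s. Q (f s)) has_vector_derivative Q (nth_deriv T (Suc i) f t)) (at t within {0..T})"
    by (rule has_vector_derivative_transform[rotated 2]) (use Suc in auto)
  then show ?case
    using vector_derivative_within_Icc[OF assms(1) Suc.prems(2)] by simp
qed simp

lemma C_k_bounded_linear:
  assumes "T > 0" "bounded_linear Q" "C_k T k f"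
  shows "C_k T k (\<lambda>s. Q (f s))"
  unfolding C_k_def
proof (intro conjI allI impI ballI)
  fix i t assume it: "i < k" "t \<in> {0..T}"
  have "((\<lambda>s. Q (nth_deriv T i f s)) has_vector_derivative Q (nth_deriv T (Suc i) f t)) (at t within {0..T})"
    by (rule bounded_linear.has_vector_derivative[OF assms(2)
          nth_deriv_has_vector_derivative[OF assms(3)]]) (use it in auto)
  then have "(nth_deriv T i (\<lambda>s. Q (f s)) has_vector_derivative Q (nth_deriv T (Suc i) f t)) (at t within {0..T})"
    by (rule has_vector_derivative_transform[rotated 2])
      (use it nth_deriv_bounded_linear[OF assms] in auto)
  then show "nth_deriv T i (\<lambda>s. Q (f s)) differentiable at t within {0..T}"
    by (rule differentiableI_vector)
next
  have "continuous_on {0..T} (\<lambda>s. Q (nth_deriv T k f s))"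
    by (rule bounded_linear.continuous_on[OF assms(2) nth_deriv_continuous_on[OF assms(3)]]) simp
  then show "continuous_on {0..T} (nth_deriv T k (\<lambda>s. Q (f s)))"
    by (rule continuous_on_eq) (use nth_deriv_bounded_linear[OF assms] in auto)
qed

section \<open>Derivatives of exponential trajectories\<close>

lemma exp_scaleR_has_vector_derivative:
  "((\<lambda>s. (a * exp (l * s)) *\<^sub>R w) has_vector_derivative (a * l * exp (l * t)) *\<^sub>R w) (at t within S)"
proof -
  have "((\<lambda>s. a * exp (l * s)) has_real_derivative a * l * exp (l * t)) (at t within S)"
    by (auto intro!: derivative_eq_intros)
  then show ?thesis
    by (auto intro!: derivative_eq_intros)
qed

lemma nth_deriv_exp:
  assumes "T > 0" "t \<in> {0..T}"
  shows "nth_deriv T i (\<lambda>s. exp (l * s) *\<^sub>R w) t = (l ^ i * exp (l * t)) *\<^sub>R w"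
  using assms(2)
proof (induction i arbitrary: t)
  case (Suc i)
  have "(nth_deriv T i (\<lambda>s. exp (l * s) *\<^sub>R w) has_vector_derivative (l ^ i * l * exp (l * t)) *\<^sub>R w) (at t within {0..T})"
    by (rule has_vector_derivative_transform[OF _ _ exp_scaleR_has_vector_derivative]) (use Suc in auto)
  then show ?case
    using vector_derivative_within_Icc[OF assms(1) Suc.prems] by (simp add: mult_ac)
qed simp

lemma C_k_exp:
  assumes "T > 0"
  shows "C_k T k (\<lambda>s. exp (l * s) *\<^sub>R w)"
  unfolding C_k_def
proof (intro conjI allI impI ballI)
  fix i t assume "i < k" and t: "t \<in> {0..T}"
  have "(nth_deriv T i (\<lambda>s. exp (l * s) *\<^sub>R w) has_vector_derivative (l ^ i * l * exp (l * t)) *\<^sub>R w) (at t within {0..T})"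
    by (rule has_vector_derivative_transform[OF _ _ exp_scaleR_has_vector_derivative])
      (use t in \<open>auto simp: nth_deriv_exp[OF assms]\<close>)
  then show "nth_deriv T i (\<lambda>s. exp (l * s) *\<^sub>R w) differentiable at t within {0..T}"
    by (rule differentiableI_vector)
next
  have "continuous_on {0..T} (\<lambda>s. (l ^ k * exp (l * s)) *\<^sub>R w)"
    by (intro continuous_intros)
  then show "continuous_on {0..T} (nth_deriv T k (\<lambda>s. exp (l * s) *\<^sub>R w))"
    by (rule continuous_on_eq) (simp add: nth_deriv_exp[OF assms])
qed

subsection \<open>Size of the perturbation\<close>

text \<open>The right-hand side of the estimate without the initial value. Naming it lets the two
  kinds of estimate share the arguments about constants.\<close>

definition perturbation_size :: "real \<Rightarrow> nat \<Rightarrow> (real \<Rightarrow> 'z::real_normed_vector) \<Rightarrow> real"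
  where "perturbation_size T p \<delta> =
    (if p = 0 then integral {0..T} (\<lambda>s. norm (\<delta> s))
     else (\<Sum>i\<in>{0..p - 1}. SUP s\<in>{0..T}. norm (nth_deriv T i \<delta> s)))"

lemma perturbation_estimate_alt:
  "perturbation_estimate T E D A p \<longleftrightarrow>
    (\<exists>c>0. \<forall>x \<delta>. C_k T (p - 1) \<delta> \<longrightarrow> classical_solution T E D A \<delta> x \<longrightarrow>
      (\<forall>t\<in>{0..T}. norm (x t) \<le> c * (norm (x 0) + perturbation_size T p \<delta>)))"
  by (simp only: perturbation_estimate_def perturbation_size_def)

lemma norm_integrable_on_Icc:
  "continuous_on {0..T} \<delta> \<Longrightarrow> (\<lambda>s::real. norm (\<delta> s)) integrable_on {0..T}"
  by (intro integrable_continuous_interval continuous_intros)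

lemma norm_nth_deriv_le_SUP:
  assumes "C_k T k \<delta>" "i \<le> k" "s \<in> {0..T}"
  shows "norm (nth_deriv T i \<delta> s) \<le> (SUP s\<in>{0..T}. norm (nth_deriv T i \<delta> s))"
proof (rule cSUP_upper[OF assms(3)])
  have "compact ((\<lambda>s. norm (nth_deriv T i \<delta> s)) ` {0..T})"
    by (intro compact_continuous_image continuous_intros nth_deriv_continuous_on[OF assms(1,2)]) simp
  then show "bdd_above ((\<lambda>s. norm (nth_deriv T i \<delta> s)) ` {0..T})"
    by (intro bounded_imp_bdd_above compact_imp_bounded)
qed

lemma norm_nth_deriv_le_perturbation_size:
  assumes "C_k T (p - 1) \<delta>" "i < p" "s \<in> {0..T}"
  shows "norm (nth_deriv T i \<delta> s) \<le> perturbation_size T p \<delta>"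
proof -
  \<comment> \<open>Bounding one summand by the whole sum requires the other suprema to be
    nonnegative. They dominate a norm at \<open>s\<close>.\<close>
  have nonneg: "0 \<le> (SUP s\<in>{0..T}. norm (nth_deriv T j \<delta> s))" if "j \<le> p - 1" for j
    using norm_nth_deriv_le_SUP[OF assms(1) that assms(3)] by (rule order_trans[OF norm_ge_zero])
  have "norm (nth_deriv T i \<delta> s) \<le> (SUP s\<in>{0..T}. norm (nth_deriv T i \<delta> s))"
    using assms by (intro norm_nth_deriv_le_SUP[OF assms(1)]) auto
  also have "\<dots> \<le> (\<Sum>i\<in>{0..p - 1}. SUP s\<in>{0..T}. norm (nth_deriv T i \<delta> s))"
    using assms(2) by (intro member_le_sum) (auto intro: nonneg)
  finally show ?thesis
    using assms(2) by (simp add: perturbation_size_def)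
qed

text \<open>The factor \<open>1 + T\<close> serves both cases: for \<open>p = 0\<close> the size is
  the integral itself, and for \<open>p > 0\<close> the integral is at most \<open>T\<close> times a
  pointwise bound on \<open>norm (\<delta> s)\<close>.\<close>

lemma integral_norm_le_perturbation_size:
  assumes "T > 0" "C_k T (p - 1) \<delta>"
  shows "integral {0..T} (\<lambda>s. norm (\<delta> s)) \<le> (1 + T) * perturbation_size T p \<delta>"
    and "0 \<le> perturbation_size T p \<delta>"
proof -
  have int: "(\<lambda>s. norm (\<delta> s)) integrable_on {0..T}"
    using norm_integrable_on_Icc nth_deriv_continuous_on[OF assms(2), of 0] by simp
  show nonneg: "0 \<le> perturbation_size T p \<delta>"
  proof (cases "p = 0")
    case True
    then show ?thesis
      using int by (simp add: perturbation_size_def integral_nonneg)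
  next
    case False
    then have "norm (nth_deriv T 0 \<delta> 0) \<le> perturbation_size T p \<delta>"
      using assms by (intro norm_nth_deriv_le_perturbation_size) auto
    then show ?thesis
      by (rule order_trans[OF norm_ge_zero])
  qed
  show "integral {0..T} (\<lambda>s. norm (\<delta> s)) \<le> (1 + T) * perturbation_size T p \<delta>"
  proof (cases "p = 0")
    case True
    have "0 \<le> T * perturbation_size T p \<delta>"
      using assms(1) nonneg by simp
    then show ?thesis
      using True by (simp add: perturbation_size_def algebra_simps)
  next
    case False
    have "integral {0..T} (\<lambda>s. norm (\<delta> s)) \<le> integral {0..T} (\<lambda>s. perturbation_size T p \<delta>)"
      using False norm_nth_deriv_le_perturbation_size[OF assms(2), of 0]
      by (intro integral_le int) auto
    then show ?thesis
      using assms(1) nonneg by (simp add: algebra_simps)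
  qed
qed

lemma perturbation_size_bounded_linear:
  assumes T: "T > 0" and Q: "bounded_linear Q" and C: "C_k T (p - 1) \<delta>"
    and K: "\<And>z. norm (Q z) \<le> norm z * K" "K \<ge> 0"
  shows "perturbation_size T p (\<lambda>s. Q (\<delta> s)) \<le> perturbation_size T p \<delta> * K"
proof (cases "p = 0")
  case True
  have cont: "continuous_on {0..T} \<delta>"
    using nth_deriv_continuous_on[OF C, of 0] by simp
  have "integral {0..T} (\<lambda>s. norm (Q (\<delta> s))) \<le> integral {0..T} (\<lambda>s. norm (\<delta> s) * K)"
    using cont K(1)
    by (intro integral_le norm_integrable_on_Icc integrable_on_mult_left
        bounded_linear.continuous_on[OF Q]) auto
  then show ?thesis
    using True by (simp add: perturbation_size_def)
next
  case False
  have "(SUP s\<in>{0..T}. norm (nth_deriv T i (\<lambda>s. Q (\<delta> s)) s)) \<le> (SUP s\<in>{0..T}. norm (nth_deriv T i \<delta> s)) * K"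
    if "i \<in> {0..p - 1}" for i
  proof (rule cSUP_least)
    fix s assume s: "s \<in> {0..T}"
    have "norm (nth_deriv T i (\<lambda>s. Q (\<delta> s)) s) \<le> norm (nth_deriv T i \<delta> s) * K"
      using nth_deriv_bounded_linear[OF T Q C _ s] that K(1) by simp
    also have "\<dots> \<le> (SUP s\<in>{0..T}. norm (nth_deriv T i \<delta> s)) * K"
      using norm_nth_deriv_le_SUP[OF C _ s] that K(2) by (intro mult_right_mono) auto
    finally show "norm (nth_deriv T i (\<lambda>s. Q (\<delta> s)) s) \<le> \<dots>" .
  qed (use T in auto)
  then show ?thesis
    using False by (auto simp: perturbation_size_def sum_distrib_right intro!: sum_mono)
qed

subsection \<open>Invariance under equivalence\<close>

text \<open>Lower bounds need an estimate carried from the pair to its Weierstrass form, upper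
  bounds the reverse.\<close>

lemma equivalent_pairs_sym:
  assumes "equivalent_pairs E D A E' D' A'"
  shows "equivalent_pairs E' D' A' E D A"
proof -
  from assms obtain P Q where P: "bounded_isomorphism P" and Q: "bounded_isomorphism Q"
    and E: "\<And>x. E x = inv Q (E' (P x))" and D: "D = {x. P x \<in> D'}"
    and A: "\<And>x. x \<in> D \<Longrightarrow> A x = inv Q (A' (P x))"
    unfolding equivalent_pairs_def by blast
  have bij: "bij P" "bij Q"
    using P Q by (auto simp: bounded_isomorphism_def)
  have PQ: "P (inv P u) = u" "Q (inv Q w) = w" for u w
    using bij by (simp_all add: bij_is_surj surj_f_inv_f)
  have "bounded_isomorphism (inv P)" "bounded_isomorphism (inv Q)"
    using P Q by (auto simp: bounded_isomorphism_def inv_inv_eq bij_imp_bij_inv)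
  moreover have "inv (inv Q) = Q"
    using bij by (simp add: inv_inv_eq)
  ultimately show ?thesis
    unfolding equivalent_pairs_def
    by (intro exI[of _ "inv P"] exI[of _ "inv Q"]) (auto simp: PQ E D A)
qed

text \<open>If \<open>x\<close> solves the original equation with perturbation
  \<open>\<delta>\<close>, then \<open>P x\<close> solves the transformed one with perturbation
  \<open>Q \<delta>\<close>. Only the constant changes.\<close>

lemma perturbation_estimate_equivalent:
  assumes T: "T > 0" and eq: "equivalent_pairs E D A E' D' A'"
    and est: "perturbation_estimate T E' D' A' p"
  shows "perturbation_estimate T E D A p"
proof -
  from eq obtain P Q where P: "bounded_isomorphism P" and Q: "bounded_isomorphism Q"
    and E: "\<And>x. E x = inv Q (E' (P x))" and D: "D = {x. P x \<in> D'}"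
    and A: "\<And>x. x \<in> D \<Longrightarrow> A x = inv Q (A' (P x))"
    unfolding equivalent_pairs_def by blast
  have bl: "bounded_linear P" "bounded_linear (inv P)" "bounded_linear Q"
    using P Q by (auto simp: bounded_isomorphism_def bounded_clinear_def)
  have inv: "inv P (P x) = x" "Q (inv Q w) = w" for x w
    using P Q by (simp_all add: bounded_isomorphism_def bij_is_inj bij_is_surj surj_f_inv_f)
  obtain K1 where K1: "K1 > 0" "\<And>x. norm (P x) \<le> norm x * K1"
    using bounded_linear.pos_bounded[OF bl(1)] by blast
  obtain K2 where K2: "K2 > 0" "\<And>x. norm (inv P x) \<le> norm x * K2"
    using bounded_linear.pos_bounded[OF bl(2)] by blast
  obtain K3 where K3: "K3 > 0" "\<And>x. norm (Q x) \<le> norm x * K3"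
    using bounded_linear.pos_bounded[OF bl(3)] by blast
  from est obtain c where c: "c > 0" and
    est: "\<And>x \<delta> t. C_k T (p - 1) \<delta> \<Longrightarrow> classical_solution T E' D' A' \<delta> x \<Longrightarrow> t \<in> {0..T} \<Longrightarrow>
      norm (x t) \<le> c * (norm (x 0) + perturbation_size T p \<delta>)"
    unfolding perturbation_estimate_alt by blast
  show ?thesis
    unfolding perturbation_estimate_alt
  \<comment> \<open>\<open>K1\<close> bounds \<open>P\<close> on the initial value,
    \<open>K3\<close> bounds \<open>Q\<close> on the perturbation, and \<open>K2\<close> bounds
    \<open>inv P\<close> on the way back. The sum \<open>K1 + K3\<close> is a common factor for the
    two terms on the right.\<close>
  proof (intro exI[of _ "c * (K1 + K3) * K2"] conjI allI impI ballI)
    show "c * (K1 + K3) * K2 > 0"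
      using c K1 K2 K3 by simp
    fix x \<delta> t
    assume C: "C_k T (p - 1) \<delta>" and sol: "classical_solution T E D A \<delta> x" and t: "t \<in> {0..T}"
    have EQ: "E' (P y) = Q (E y)" for y
      by (simp add: E inv)
    have AQ: "A' (P (x s)) = Q (A (x s))" if "s \<in> {0..T}" for s
      using that sol by (simp add: A inv classical_solution_def)
    have "classical_solution T E' D' A' (\<lambda>s. Q (\<delta> s)) (\<lambda>s. P (x s))"
      unfolding classical_solution_def EQ
    proof (intro conjI ballI)
      show "P (x s) \<in> D'" if "s \<in> {0..T}" for s
        using that sol D by (auto simp: classical_solution_def)
      show "C_k T 1 (\<lambda>t. Q (E (x t)))"
        by (rule C_k_bounded_linear[OF T bl(3)]) (use sol in \<open>simp add: classical_solution_def\<close>)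
      fix s assume s: "s \<in> {0..T}"
      have "((\<lambda>s. Q (E (x s))) has_vector_derivative Q (A (x s) + \<delta> s)) (at s within {0..T})"
        by (rule bounded_linear.has_vector_derivative[OF bl(3)])
          (use s sol in \<open>simp add: classical_solution_def\<close>)
      then show "((\<lambda>s. Q (E (x s))) has_vector_derivative A' (P (x s)) + Q (\<delta> s)) (at s within {0..T})"
        by (simp add: AQ[OF s] bounded_linear.linear[OF bl(3)] linear_add)
    qed
    then have "norm (P (x t)) \<le> c * (norm (P (x 0)) + perturbation_size T p (\<lambda>s. Q (\<delta> s)))"
      by (rule est[OF C_k_bounded_linear[OF T bl(3) C] _ t])
    also have "\<dots> \<le> c * (norm (x 0) * K1 + perturbation_size T p \<delta> * K3)"
      using c K1 K3 perturbation_size_bounded_linear[OF T bl(3) C K3(2)]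
      by (intro mult_left_mono add_mono) auto
    also have "\<dots> \<le> c * ((K1 + K3) * (norm (x 0) + perturbation_size T p \<delta>))"
      using c K1 K3 integral_norm_le_perturbation_size(2)[OF T C]
      by (intro mult_left_mono) (auto simp: algebra_simps)
    finally have "norm (P (x t)) \<le> c * ((K1 + K3) * (norm (x 0) + perturbation_size T p \<delta>))" .
    then have "norm (inv P (P (x t))) \<le> c * ((K1 + K3) * (norm (x 0) + perturbation_size T p \<delta>)) * K2"
      using K2 by (meson mult_right_mono order_trans less_imp_le)
    then show "norm (x t) \<le> c * (K1 + K3) * K2 * (norm (x 0) + perturbation_size T p \<delta>)"
      by (simp add: inv mult_ac)
  qed
qed

subsection \<open>Lower bounds\<close>

text \<open>The trajectory \<open>exp (l * t) *\<^sub>R v\<close> ends with norm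
  \<open>exp (l * T) * norm v\<close>, against which its initial norm is negligible for large
  \<open>l\<close>. Both sides carry an extra factor \<open>l\<close>, so that \<open>q = 0\<close>
  involves no negative exponent.\<close>

lemma perturbation_estimate_pencil_bound:
  fixes E :: "'x::complex_normed_vector \<Rightarrow> 'z::complex_normed_vector"
  assumes T: "T > 0" and E: "bounded_linear E" and A: "linear_operator D A"
    and est: "perturbation_estimate T E D A q"
  shows "\<exists>C L. \<forall>l\<ge>L. \<forall>v\<in>D. l * norm v \<le> C * l ^ q * norm (l *\<^sub>R E v - A v)"
proof -
  from est obtain c where c: "c > 0" and
    est: "\<And>x \<delta> t. C_k T (q - 1) \<delta> \<Longrightarrow> classical_solution T E D A \<delta> x \<Longrightarrow> t \<in> {0..T} \<Longrightarrow>
      norm (x t) \<le> c * (norm (x 0) + perturbation_size T q \<delta>)"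
    unfolding perturbation_estimate_alt by blast
  \<comment> \<open>Beyond \<open>L\<close> the powers of \<open>l\<close> increase with the
    exponent and \<open>2 * c \<le> exp (l * T)\<close> holds, so the initial value can be
    absorbed.\<close>
  define L where "L = max 1 (ln (2 * c) / T)"
  have "l * norm v \<le> 2 * c * (q + 1) * l ^ q * norm (l *\<^sub>R E v - A v)" if l: "l \<ge> L" and v: "v \<in> D" for l v
  proof -
    define w where "w = l *\<^sub>R E v - A v"
    have l1: "l \<ge> 1"
      using l by (simp add: L_def)
    have "ln (2 * c) \<le> l * T"
      using l T by (simp add: L_def field_simps)
    then have e: "2 * c \<le> exp (l * T)"
      using c by (metis exp_le_cancel_iff exp_ln zero_less_mult_iff zero_less_numeral)
    let ?x = "\<lambda>t. exp (l * t) *\<^sub>R v" and ?\<delta> = "\<lambda>t. exp (l * t) *\<^sub>R w"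
    have Ex: "E (?x s) = exp (l * s) *\<^sub>R E v" for s
      using E by (simp add: bounded_linear.linear linear_scale)
    have Ax: "A (?x s) = exp (l * s) *\<^sub>R A v" for s
      using A v by (simp add: linear_operator_scaleR)
    have "classical_solution T E D A ?\<delta> ?x"
      unfolding classical_solution_def
    proof (intro conjI ballI)
      show "?x s \<in> D" for s
        using A v by (simp add: linear_operator_scaleR_mem)
      show "C_k T 1 (\<lambda>t. E (?x t))"
        unfolding Ex by (rule C_k_exp[OF T])
      show "((\<lambda>s. E (?x s)) has_vector_derivative A (?x s) + ?\<delta> s) (at s within {0..T})" for s
        unfolding Ex Ax
        using exp_scaleR_has_vector_derivative[of 1 l "E v" s "{0..T}"]
        by (simp add: w_def algebra_simps)
    qed
    then have "norm (?x T) \<le> c * (norm (?x 0) + perturbation_size T q ?\<delta>)"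
      using T by (intro est C_k_exp) auto
    then have 1: "exp (l * T) * norm v \<le> c * norm v + c * perturbation_size T q ?\<delta>"
      by (simp add: algebra_simps)
    \<comment> \<open>For \<open>q = 0\<close>, integrating the exponential gains a factor
      \<open>1 / l\<close>. For \<open>q > 0\<close> there are \<open>q\<close> summands, each at
      most of order \<open>l ^ (q - 1)\<close>. The coefficient \<open>q + 1\<close> covers both
      cases.\<close>
    have size: "l * perturbation_size T q ?\<delta> \<le> (q + 1) * l ^ q * exp (l * T) * norm w"
    proof (cases "q = 0")
      case True
      have "((\<lambda>s. exp (l * s) * norm w) has_integral
          (exp (l * T) * norm w / l - exp (l * 0) * norm w / l)) {0..T}"
        using T l1 by (intro fundamental_theorem_of_calculus)
          (auto simp: has_real_derivative_iff_has_vector_derivative[symmetric] intro!: derivative_eq_intros)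
      then have "integral {0..T} (\<lambda>s. norm (?\<delta> s)) = exp (l * T) * norm w / l - norm w / l"
        by (intro integral_unique) simp
      then have "l * perturbation_size T q ?\<delta> = exp (l * T) * norm w - norm w"
        using True l1 by (simp only: perturbation_size_def) (simp add: algebra_simps)
      then show ?thesis
        using True by simp
    next
      case False
      have "perturbation_size T q ?\<delta> \<le> (\<Sum>i\<in>{0..q - 1}. l ^ (q - 1) * exp (l * T) * norm w)"
        unfolding perturbation_size_def if_not_P[OF False]
      proof (intro sum_mono cSUP_least)
        fix i s assume i: "i \<in> {0..q - 1}" and s: "s \<in> {0..T}"
        have "norm (nth_deriv T i ?\<delta> s) = l ^ i * exp (l * s) * norm w"
          using l1 by (simp add: nth_deriv_exp[OF T s])
        also have "\<dots> \<le> l ^ (q - 1) * exp (l * T) * norm w"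
          using i s l1 by (intro mult_right_mono mult_mono power_increasing) auto
        finally show "norm (nth_deriv T i ?\<delta> s) \<le> \<dots>" .
      qed (use T in auto)
      also have "\<dots> = q * (l ^ (q - 1) * exp (l * T) * norm w)"
        using False by simp
      finally have "l * perturbation_size T q ?\<delta> \<le> l * (q * (l ^ (q - 1) * exp (l * T) * norm w))"
        using l1 by (intro mult_left_mono) auto
      also have "\<dots> = q * (l * l ^ (q - 1)) * exp (l * T) * norm w"
        by (simp add: mult_ac)
      also have "l * l ^ (q - 1) = l ^ q"
        using False by (simp add: power_eq_if)
      also have "q * l ^ q * exp (l * T) * norm w \<le> (q + 1) * l ^ q * exp (l * T) * norm w"
        using l1 by (intro mult_right_mono) auto
      finally show ?thesis .
    qed
    have "exp (l * T) * (l * norm v) = l * (exp (l * T) * norm v)"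
      by simp
    also have "\<dots> \<le> l * (c * norm v + c * perturbation_size T q ?\<delta>)"
      using l1 by (intro mult_left_mono 1) auto
    also have "\<dots> = c * (l * norm v) + c * (l * perturbation_size T q ?\<delta>)"
      by (simp add: algebra_simps)
    \<comment> \<open>The term from the initial value is at most half of the left-hand side, into
      which it is then absorbed; this doubles the constant.\<close>
    also have "\<dots> \<le> exp (l * T) / 2 * (l * norm v) + c * ((q + 1) * l ^ q * exp (l * T) * norm w)"
      using e l1 c by (intro add_mono mult_mono mult_left_mono size) auto
    finally have "exp (l * T) * (l * norm v) \<le> exp (l * T) * (2 * c * (q + 1) * l ^ q * norm w)"
      by (simp add: algebra_simps)
    then show ?thesis
      unfolding w_def by (rule mult_left_le_imp_le) simp
  qed
  then show ?thesis
    by blast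
qed

section \<open>Growth of the resolvent of a nilpotent block\<close>

lemma bounded_linear_funpow:
  fixes N :: "'a::real_normed_vector \<Rightarrow> 'a"
  shows "bounded_linear N \<Longrightarrow> bounded_linear (N ^^ i)"
proof (induction i)
  case 0
  show ?case
    using bounded_linear_ident[where 'a = 'a] by (simp add: id_def)
next
  case (Suc i)
  then show ?case
    using bounded_linear_compose[of N "N ^^ i"] by (simp add: comp_def)
qed

text \<open>The equation \<open>l N v - v = -w\<close> is solved by \<open>v = (\<Sum>i<p. l\<^sup>i N\<^sup>i w)\<close>, which grows like \<open>l\<^sup>p\<^sup>-\<^sup>1\<close>.\<close>

lemma nilpotency_degree_le:
  fixes N :: "'a::real_normed_vector \<Rightarrow> 'a"
  assumes N: "bounded_linear N" and deg: "nilpotency_degree N p"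
    and bound: "\<And>l v. l \<ge> L \<Longrightarrow> l * norm v \<le> C * l ^ q * norm (l *\<^sub>R N v - v)"
  shows "p \<le> q"
proof (rule ccontr)
  assume "\<not> p \<le> q"
  \<comment> \<open>\<open>N ^^ m\<close> is the highest nonvanishing power, and the assumed bound
    has order at most \<open>l ^ m\<close> after the factor \<open>l\<close> is split off on the
    left.\<close>
  then obtain m where m: "p = Suc m" "q \<le> m"
    by (metis Suc_le_D not_less_eq_eq Suc_le_mono)
  from deg obtain w where w: "(N ^^ m) w \<noteq> 0" and Np: "\<And>z. (N ^^ p) z = 0"
    unfolding nilpotency_degree_def m(1) by (metis ext lessI)
  \<comment> \<open>With \<open>u = 1 / l\<close> this is \<open>v\<close> divided by
    \<open>l ^ m\<close>, which turns the limit at infinity into one at 0 from the right. There only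
    the summand \<open>i = m\<close> survives, because \<open>0 ^ 0 = 1\<close>.\<close>
  define g where "g u = (\<Sum>i\<le>m. u ^ (m - i) *\<^sub>R (N ^^ i) w)" for u :: real
  have "(g \<longlongrightarrow> (\<Sum>i\<le>m. 0 ^ (m - i) *\<^sub>R (N ^^ i) w)) (at_right 0)"
    unfolding g_def by (intro tendsto_intros)
  moreover have "(\<Sum>i\<le>m. 0 ^ (m - i) *\<^sub>R (N ^^ i) w) = (N ^^ m) w"
    by (subst sum.remove[of _ m]) (auto intro!: sum.neutral)
  ultimately have g: "((\<lambda>u. norm (g u)) \<longlongrightarrow> norm ((N ^^ m) w)) (at_right 0)"
    by (simp add: tendsto_norm)
  have "norm (g u) \<le> max 0 C * u * norm w" if u: "u > 0" "u < 1 / max 1 L" for u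
  proof -
    define l where "l = 1 / u"
    have "0 < max 1 L"
      by simp
    then have "max 1 L * u < 1"
      using u(2) by (simp only: pos_less_divide_eq mult.commute)
    then have "max 1 L < l"
      unfolding l_def by (rule mult_imp_less_div_pos[OF u(1)])
    then have l: "l \<ge> 1" "l \<ge> L"
      by auto
    define v where "v = (\<Sum>i\<le>m. l ^ i *\<^sub>R (N ^^ i) w)"
    have "v = (\<Sum>i\<le>m. l ^ m *\<^sub>R (u ^ (m - i) *\<^sub>R (N ^^ i) w))"
      unfolding v_def using u
      by (intro sum.cong refl) (simp add: l_def power_diff field_simps)
    then have v: "v = l ^ m *\<^sub>R g u"
      by (simp add: g_def scaleR_sum_right)
    have "l *\<^sub>R N v = (\<Sum>i\<le>m. l ^ Suc i *\<^sub>R (N ^^ Suc i) w)"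
      using N by (simp add: v_def bounded_linear.linear linear_sum linear_scale scaleR_sum_right)
    then have "l *\<^sub>R N v - v = (\<Sum>i\<le>m. l ^ Suc i *\<^sub>R (N ^^ Suc i) w - l ^ i *\<^sub>R (N ^^ i) w)"
      by (simp only: v_def sum_subtractf)
    \<comment> \<open>The sum telescopes, and its top term vanishes because \<open>N ^^ p\<close> is
      zero.\<close>
    also have "\<dots> = l ^ p *\<^sub>R (N ^^ p) w - w"
      using sum_lessThan_telescope[of "\<lambda>i. l ^ i *\<^sub>R (N ^^ i) w" p]
      by (simp only: m(1) lessThan_Suc_atMost) simp
    finally have Nv: "l *\<^sub>R N v - v = - w"
      by (simp add: Np)
    have "l * (l ^ m * norm (g u)) = l * norm v"
      using l by (simp add: v)
    also have "\<dots> \<le> C * l ^ q * norm w"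
      using bound[OF l(2), of v] by (simp only: Nv norm_minus_cancel)
    \<comment> \<open>The sign of \<open>C\<close> is not known, so it is replaced by
      \<open>max 0 C\<close> before the exponent is raised from \<open>q\<close> to
      \<open>m\<close>.\<close>
    also have "\<dots> \<le> max 0 C * l ^ m * norm w"
      using l m by (intro mult_right_mono mult_mono power_increasing) auto
    finally have "l ^ m * (l * norm (g u)) \<le> l ^ m * (max 0 C * norm w)"
      by (simp add: mult_ac)
    then have "l * norm (g u) \<le> max 0 C * norm w"
      by (rule mult_left_le_imp_le) (use l in simp)
    then show ?thesis
      using u by (simp add: l_def field_simps)
  qed
  then have "\<forall>\<^sub>F u in at_right 0. norm (g u) \<le> max 0 C * u * norm w"
    by (intro eventually_at_rightI[of 0 "1 / max 1 L"]) auto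
  moreover have "((\<lambda>u. max 0 C * u * norm w) \<longlongrightarrow> max 0 C * 0 * norm w) (at_right 0)"
    by (intro tendsto_intros)
  \<comment> \<open>Passing to the limit in a bound of order \<open>u\<close> forces the nonzero
    vector \<open>(N ^^ m) w\<close> to have norm 0.\<close>
  ultimately have "norm ((N ^^ m) w) \<le> max 0 C * 0 * norm w"
    by (intro tendsto_le[OF _ _ g]) auto
  then show False
    using w by simp
qed

text \<open>The estimate is moved to the Weierstrass form and tested on the vectors
  \<open>(0, v)\<close>, which see the nilpotent block alone. An absent block gives
  \<open>p = 0\<close>, where the claim is trivial.\<close>

lemma weierstrass_index_le_perturbation_index:
  fixes E :: "'x::complex_normed_vector \<Rightarrow> 'z::complex_normed_vector"
    and D1 :: "'y1::chilbert_space set"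
  assumes T: "T > 0" and ind: "weierstrass_index TYPE('y2::chilbert_space) E D A D1 A1 p"
    and est: "perturbation_estimate T E D A q"
  shows "p \<le> q"
proof (cases "p = 0")
  case False
  with ind obtain N :: "'y2 \<Rightarrow> 'y2" where N: "bounded_linear N" "nilpotency_degree N p"
    and A1: "linear_operator D1 A1" and equiv: "equivalent_pairs E D A
      (\<lambda>(y1, y2). (y1, N y2)) (D1 \<times> UNIV) (\<lambda>(y1, y2). (A1 y1, y2))"
    unfolding weierstrass_index_def weierstrass_form_def by (auto simp: bounded_clinear_def)
  let ?E = "\<lambda>(y1::'y1, y2). (y1, N y2)" and ?A = "\<lambda>(y1, y2::'y2). (A1 y1, y2)"
  have E: "bounded_linear ?E"
    unfolding case_prod_beta
    by (intro bounded_linear_Pair bounded_linear_fst bounded_linear_compose[OF N(1)] bounded_linear_snd)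
  have A: "linear_operator (D1 \<times> UNIV) ?A"
    using A1 by (auto simp: linear_operator_def scaleC_prod_def zero_prod_def)
  have est': "perturbation_estimate T ?E (D1 \<times> UNIV) ?A q"
    using perturbation_estimate_equivalent[OF T equivalent_pairs_sym[OF equiv] est] .
  obtain C L where CL: "\<forall>l\<ge>L. \<forall>v\<in>D1 \<times> UNIV. l * norm v \<le> C * l ^ q * norm (l *\<^sub>R ?E v - ?A v)"
    using perturbation_estimate_pencil_bound[OF T E A est'] by (elim exE) (rule that)
  have "l * norm v \<le> C * l ^ q * norm (l *\<^sub>R N v - v)" if "l \<ge> L" for l v
    using CL[rule_format, OF that, of "(0, v)"] linear_operator_zero_mem[OF A1] linear_operator_zero[OF A1]
    by (simp add: norm_Pair)
  then show ?thesis
    by (rule nilpotency_degree_le[OF N])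
qed simp

subsection \<open>Strongly continuous semigroups\<close>

lemma C0_semigroupD:
  assumes "C0_semigroup S"
  shows "t \<ge> 0 \<Longrightarrow> bounded_linear (S t)" "S 0 y = y"
    "s \<ge> 0 \<Longrightarrow> t \<ge> 0 \<Longrightarrow> S (s + t) y = S s (S t y)"
    "((\<lambda>t. S t y) \<longlongrightarrow> y) (at_right 0)"
  using assms by (auto simp: C0_semigroup_def bounded_clinear_def)

text \<open>Rescale \<open>x\<close> to a vector \<open>u\<close> of norm \<open>r / 2\<close> and
  write \<open>f u = f (a + u) - f a\<close>. The two values contribute \<open>2 * K\<close>, and
  undoing the scaling contributes \<open>2 / r\<close>.\<close>

lemma bounded_on_ball_imp_norm_bound:
  assumes "linear f" "r > 0" and bound: "\<And>x. x \<in> ball a r \<Longrightarrow> norm (f x) \<le> K"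
  shows "norm (f x) \<le> (4 * K / r) * norm x"
proof (cases "x = 0")
  case True
  then show ?thesis
    using assms(1) by (simp add: linear_0)
next
  case False
  define u where "u = (r / (2 * norm x)) *\<^sub>R x"
  have "norm u < r"
    using False assms(2) by (simp add: u_def)
  then have "norm (f (a + u)) \<le> K" "norm (f a) \<le> K"
    using assms(2) by (auto intro!: bound simp: dist_norm)
  moreover have "f u = f (a + u) - f a"
    using assms(1) by (simp add: linear_add)
  ultimately have "norm (f u) \<le> 2 * K"
    using norm_triangle_ineq4[of "f (a + u)" "f a"] by simp
  moreover have "norm (f u) = r / (2 * norm x) * norm (f x)"
    using assms(1,2) by (simp add: u_def linear_scale)
  ultimately show ?thesis
    using False assms(2) by (simp add: field_simps)
qed

text \<open>Uniform boundedness near \<open>0\<close> by Baire's theorem: the closed sets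
  \<open>F n = {y. \<forall>t\<in>[0, 1/(n+1)]. \<parallel>S t y\<parallel> \<le> n}\<close> cover the space.\<close>

lemma C0_semigroup_bounded_near_0:
  fixes S :: "real \<Rightarrow> 'a::cbanach \<Rightarrow> 'a"
  assumes S: "C0_semigroup S"
  obtains h M where "h > 0" "M \<ge> 1" "\<And>t y. t \<in> {0..h} \<Longrightarrow> norm (S t y) \<le> M * norm y"
proof -
  define F where "F n = (\<Inter>t\<in>{0..1 / (real n + 1)}. {y. norm (S t y) \<le> real n})" for n
  have closed: "closed (F n)" for n
    unfolding F_def
    by (intro closed_INT ballI closed_Collect_le continuous_intros
        bounded_linear.continuous_on[OF C0_semigroupD(1)[OF S]]) auto
  have "y \<in> \<Union>(range F)" for y
  proof -
    have "\<forall>\<^sub>F t in at_right 0. dist (S t y) y < 1"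
      using C0_semigroupD(4)[OF S] by (rule tendstoD) simp
    then obtain d where d: "d > 0" "\<And>t. 0 < t \<Longrightarrow> t < d \<Longrightarrow> dist (S t y) y < 1"
      by (auto simp: eventually_at_right_field)
    \<comment> \<open>The choice puts \<open>{0..1 / (real n + 1)}\<close> inside the range where
      \<open>S t y\<close> is within 1 of \<open>y\<close>, and makes \<open>n\<close> exceed
      \<open>norm y + 1\<close>. Time 0 is treated separately, as the limit from the right does not
      see it.\<close>
    obtain n where n: "max (1 / d) (norm y + 1) < real n"
      using reals_Archimedean2 by blast
    have "norm (S t y) \<le> real n" if t: "t \<in> {0..1 / (real n + 1)}" for t
    proof (cases "t = 0")
      case True
      then show ?thesis
        using n C0_semigroupD(2)[OF S, of y] by simp
    next
      case False
      have "1 < real n * d"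
        using n d(1) by (simp add: pos_divide_less_eq)
      then have "1 < d * (real n + 1)"
        using d(1) by (simp add: algebra_simps)
      then have "1 / (real n + 1) < d"
        by (simp add: pos_divide_less_eq add_pos_pos add_nonneg_pos)
      then have "dist (S t y) y < 1"
        using t False by (intro d(2)) auto
      then have "norm (S t y - y) < 1"
        by (simp add: dist_norm)
      then show ?thesis
        using n norm_triangle_sub[of "S t y" y] by simp
    qed
    then have "y \<in> F n"
      by (simp add: F_def)
    then show ?thesis
      by blast
  qed
  then have "\<Union>(range F) = UNIV"
    by blast
  \<comment> \<open>Baire: countably many closed sets with empty interior cannot cover a complete
    space, so some \<open>F n\<close> contains a ball.\<close>
  moreover have "interior (\<Union>(range F)) = {}" if "\<And>n. interior (F n) = {}"
    using Baire_category_alt[of "euclidean :: 'a topology" "range F"] that closed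
    by (auto simp: completely_metrizable_space_euclidean)
  ultimately obtain n where "interior (F n) \<noteq> {}"
    by (metis UNIV_not_empty interior_UNIV)
  then obtain a r where r: "r > 0" "ball a r \<subseteq> F n"
    by (metis all_not_in_conv mem_interior)
  have "norm (S t y) \<le> max 1 (4 * real n / r) * norm y" if t: "t \<in> {0..1 / (real n + 1)}" for t y
  proof -
    have "norm (S t y) \<le> (4 * real n / r) * norm y"
    proof (rule bounded_on_ball_imp_norm_bound[OF _ r(1)])
      show "linear (S t)"
        using t by (intro bounded_linear.linear C0_semigroupD(1)[OF S]) auto
      show "norm (S t z) \<le> real n" if "z \<in> ball a r" for z
        using that r(2) t by (auto simp: F_def)
    qed
    also have "\<dots> \<le> max 1 (4 * real n / r) * norm y"
      by (intro mult_right_mono) auto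
    finally show ?thesis .
  qed
  then show ?thesis
    by (rule that[rotated 2]) (auto simp: add_nonneg_pos)
qed

text \<open>The semigroup law splits a time up to \<open>n * h\<close> into at most \<open>n\<close>
  steps of length at most \<open>h\<close>, each costing a factor \<open>M\<close>.\<close>

lemma C0_semigroup_bounded:
  fixes S :: "real \<Rightarrow> 'a::cbanach \<Rightarrow> 'a"
  assumes S: "C0_semigroup S"
  obtains M where "M \<ge> 1" "\<And>t y. t \<in> {0..T} \<Longrightarrow> norm (S t y) \<le> M * norm y"
proof -
  obtain h M where h: "h > 0" and M: "M \<ge> 1"
    and bound: "\<And>t y. t \<in> {0..h} \<Longrightarrow> norm (S t y) \<le> M * norm y"
    using C0_semigroup_bounded_near_0[OF S] by blast
  have iter: "norm (S t y) \<le> M ^ n * norm y" if "t \<in> {0..real n * h}" for n t y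
    using that
  proof (induction n arbitrary: t)
    case 0
    then show ?case
      using C0_semigroupD(2)[OF S] by simp
  next
    case (Suc n)
    show ?case
    proof (cases "t \<le> h")
      case True
      then have "norm (S t y) \<le> M * norm y"
        using Suc.prems by (intro bound) auto
      also have "\<dots> \<le> M ^ Suc n * norm y"
        using M power_increasing[of 1 "Suc n" M] by (intro mult_right_mono) auto
      finally show ?thesis .
    next
      case False
      have "S t y = S h (S (t - h) y)"
        using False h C0_semigroupD(3)[OF S, of h "t - h" y] by simp
      then have "norm (S t y) \<le> M * norm (S (t - h) y)"
        using h by (simp add: bound)
      also have "\<dots> \<le> M * (M ^ n * norm y)"
        using M False Suc.prems by (intro mult_left_mono Suc.IH) (auto simp: algebra_simps)
      finally show ?thesis
        by (simp add: mult_ac)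
    qed
  qed
  obtain n where n: "T / h < real n"
    using reals_Archimedean2 by blast
  show ?thesis
  proof (rule that)
    show "M ^ n \<ge> 1"
      using M by (rule one_le_power)
    have "T \<le> real n * h"
      using n h by (simp add: pos_divide_less_eq)
    then show "norm (S t y) \<le> M ^ n * norm y" if "t \<in> {0..T}" for t y
      using that by (intro iter) auto
  qed
qed

text \<open>Factoring out the operator at the smaller time leaves \<open>S\<close> at the time
  difference, so two-sided continuity in time reduces to right continuity at 0.\<close>

lemma C0_semigroup_norm_diff_le:
  fixes S :: "real \<Rightarrow> 'a::complex_normed_vector \<Rightarrow> 'a"
  assumes S: "C0_semigroup S" and bound: "\<And>t y. t \<in> {0..T} \<Longrightarrow> norm (S t y) \<le> M * norm y"
    and rs: "r \<in> {0..T}" "s \<in> {0..T}"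
  shows "norm (S s y - S r y) \<le> M * norm (S \<bar>s - r\<bar> y - y)"
proof -
  have "norm (S s y - S r y) \<le> M * norm (S (s - r) y - y)" if "r \<le> s" "r \<in> {0..T}" for r s
  proof -
    have "S s y = S r (S (s - r) y)"
      using that C0_semigroupD(3)[OF S, of r "s - r" y] by simp
    then have "S s y - S r y = S r (S (s - r) y - y)"
      using that by (simp add: linear_diff bounded_linear.linear C0_semigroupD(1)[OF S])
    then show ?thesis
      using bound[OF that(2)] by simp
  qed
  from this[of r s] this[of s r] rs show ?thesis
    by (cases "r \<le> s") (auto simp: norm_minus_commute)
qed

text \<open>Joint continuity, from strong continuity and the uniform bound. In the difference
  quotients below, the time and the vector vary together.\<close>

lemma C0_semigroup_tendsto:
  fixes S :: "real \<Rightarrow> 'a::complex_normed_vector \<Rightarrow> 'a"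
  assumes S: "C0_semigroup S" and bound: "\<And>t y. t \<in> {0..T} \<Longrightarrow> norm (S t y) \<le> M * norm y"
    and M: "M \<ge> 1"
    and r: "(r \<longlongrightarrow> r0) F" "\<forall>\<^sub>F u in F. r u \<in> {0..T}" "r0 \<in> {0..T}"
    and v: "(v \<longlongrightarrow> v0) F"
  shows "((\<lambda>u. S (r u) (v u)) \<longlongrightarrow> S r0 v0) F"
proof -
  have at0: "((\<lambda>h. S h v0) \<longlongrightarrow> v0) (at 0 within {0..})"
  proof -
    have "at (0::real) within {0..} = at_right 0"
      by (auto simp: at_within_def greaterThan_def atLeast_def intro!: arg_cong2[where f = inf] arg_cong[where f = principal])
    then show ?thesis
      using C0_semigroupD(4)[OF S] by simp
  qed
  have lim: "((\<lambda>h. norm (S h v0 - v0)) \<longlongrightarrow> 0) (at 0 within {0..})"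
    using at0 by (simp add: LIM_zero tendsto_norm_zero)
  have abs: "((\<lambda>u. \<bar>r u - r0\<bar>) \<longlongrightarrow> 0) F"
    using r(1) by (simp add: LIM_zero tendsto_rabs_zero)
  \<comment> \<open>The difference \<open>\<bar>r u - r0\<bar>\<close> may be 0, a value that
    \<open>at_right 0\<close> leaves out. Continuity at 0, with \<open>S 0\<close> the identity,
    includes it.\<close>
  have "continuous (at 0 within {0..}) (\<lambda>h. norm (S h v0 - v0))"
    using lim C0_semigroupD(2)[OF S] by (simp add: continuous_within)
  then have "((\<lambda>u. norm (S \<bar>r u - r0\<bar> v0 - v0)) \<longlongrightarrow> norm (S 0 v0 - v0)) F"
    by (rule continuous_within_tendsto_compose'[OF _ _ abs]) simp
  then have small: "((\<lambda>u. norm (S \<bar>r u - r0\<bar> v0 - v0)) \<longlongrightarrow> 0) F"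
    using C0_semigroupD(2)[OF S] by simp
  have v': "((\<lambda>u. norm (v u - v0)) \<longlongrightarrow> 0) F"
    using v by (simp add: LIM_zero tendsto_norm_zero)
  have "((\<lambda>u. M * norm (v u - v0) + M * norm (S \<bar>r u - r0\<bar> v0 - v0)) \<longlongrightarrow> M * 0 + M * 0) F"
    by (intro tendsto_intros small v')
  then have *: "((\<lambda>u. M * norm (v u - v0) + M * norm (S \<bar>r u - r0\<bar> v0 - v0)) \<longlongrightarrow> 0) F"
    by simp
  have "\<forall>\<^sub>F u in F. norm (S (r u) (v u) - S r0 v0)
      \<le> M * norm (v u - v0) + M * norm (S \<bar>r u - r0\<bar> v0 - v0)"
    using r(2)
  proof (rule eventually_mono)
    fix u assume u: "r u \<in> {0..T}"
    have split: "S (r u) (v u) - S r0 v0 = S (r u) (v u - v0) + (S (r u) v0 - S r0 v0)"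
      using u by (simp add: linear_diff bounded_linear.linear C0_semigroupD(1)[OF S])
    show "norm (S (r u) (v u) - S r0 v0)
      \<le> M * norm (v u - v0) + M * norm (S \<bar>r u - r0\<bar> v0 - v0)"
      unfolding split using norm_triangle_ineq[of "S (r u) (v u - v0)" "S (r u) v0 - S r0 v0"]
        bound[OF u, of "v u - v0"] C0_semigroup_norm_diff_le[OF S bound r(3) u, of v0] by simp
  qed
  then have "((\<lambda>u. S (r u) (v u) - S r0 v0) \<longlongrightarrow> 0) F"
    by (rule Lim_null_comparison) (rule *)
  then show ?thesis
    by (rule LIM_zero_cancel)
qed

text \<open>Semigroup operators have nonnegative times, so the left quotient is also written with a
  step \<open>h\<close> tending to 0 from the right.\<close>

lemma has_vector_derivative_iff_one_sided:
  fixes g :: "real \<Rightarrow> 'a::real_normed_vector"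
  shows "(g has_vector_derivative g') (at s) \<longleftrightarrow>
    ((\<lambda>h. (1 / h) *\<^sub>R (g (s + h) - g s)) \<longlongrightarrow> g') (at_right 0) \<and>
    ((\<lambda>h. (1 / h) *\<^sub>R (g s - g (s - h))) \<longlongrightarrow> g') (at_right 0)"
proof -
  let ?q = "\<lambda>h. (1 / h) *\<^sub>R (g (s + h) - g s)"
  have left: "(1 / - h) *\<^sub>R (g (s + - h) - g s) = (1 / h) *\<^sub>R (g s - g (s - h))" for h
    by (simp add: scaleR_diff_right)
  have eq: "norm (g (s + h) - g s - h *\<^sub>R g') / norm h = norm (?q h - g')" if "h \<noteq> 0" for h
  proof -
    have "?q h - g' = (1 / h) *\<^sub>R (g (s + h) - g s - h *\<^sub>R g')"
      using that by (simp add: scaleR_diff_right)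
    then show ?thesis
      by simp
  qed
  have "(g has_vector_derivative g') (at s) \<longleftrightarrow> (\<lambda>h. norm (g (s + h) - g s - h *\<^sub>R g') / norm h) \<midarrow>0\<rightarrow> 0"
    by (simp add: has_vector_derivative_def has_derivative_at bounded_linear_scaleR_left)
  also have "\<dots> \<longleftrightarrow> (\<lambda>h. norm (?q h - g')) \<midarrow>0\<rightarrow> 0"
    by (intro filterlim_cong refl) (use eq in \<open>unfold eventually_at_filter, intro always_eventually, blast\<close>)
  also have "\<dots> \<longleftrightarrow> ?q \<midarrow>0\<rightarrow> g'"
    by (simp only: tendsto_norm_zero_iff LIM_zero_iff)
  finally show ?thesis
    by (simp only: filterlim_at_split filterlim_at_left_to_right left minus_zero conj_commute)
qed

text \<open>With \<open>g s = S (t - s) (y s)\<close> one has \<open>g' s = S (t - s) (d s)\<close>, as the two terms with \<open>A\<close> cancel.\<close>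

lemma generates_C0_semigroup_estimate:
  fixes A :: "'a::cbanach \<Rightarrow> 'a"
  assumes gen: "generates_C0_semigroup D A"
  obtains M where "M > 0" "\<And>y d t. continuous_on {0..T} d \<Longrightarrow> (\<And>s. s \<in> {0..T} \<Longrightarrow> y s \<in> D) \<Longrightarrow>
    (\<And>s. s \<in> {0..T} \<Longrightarrow> (y has_vector_derivative A (y s) + d s) (at s within {0..T})) \<Longrightarrow> t \<in> {0..T} \<Longrightarrow>
    norm (y t) \<le> M * (norm (y 0) + integral {0..T} (\<lambda>s. norm (d s)))"
proof -
  from gen obtain S where S: "C0_semigroup S"
    and gen: "\<And>y. y \<in> D \<Longrightarrow> ((\<lambda>h. (1 / h) *\<^sub>R (S h y - y)) \<longlongrightarrow> A y) (at_right 0)"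
    unfolding generates_C0_semigroup_def by blast
  obtain M where M: "M \<ge> 1" and bound: "\<And>t y. t \<in> {0..T} \<Longrightarrow> norm (S t y) \<le> M * norm y"
    using C0_semigroup_bounded[OF S] by blast
  have tends: "((\<lambda>u. S (r u) (v u)) \<longlongrightarrow> S r0 v0) F"
    if "(r \<longlongrightarrow> r0) F" "\<forall>\<^sub>F u in F. r u \<in> {0..T}" "r0 \<in> {0..T}" "(v \<longlongrightarrow> v0) F"
    for r r0 v v0 and F :: "real filter"
    using C0_semigroup_tendsto[OF S bound M that] .
  note lin = bounded_linear.linear[OF C0_semigroupD(1)[OF S]]
  show ?thesis
  proof (rule that)
    show "M > 0"
      using M by simp
    fix y :: "real \<Rightarrow> 'a" and d t
    assume d: "continuous_on {0..T} d" and D: "\<And>s. s \<in> {0..T} \<Longrightarrow> y s \<in> D"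
      and y': "\<And>s. s \<in> {0..T} \<Longrightarrow> (y has_vector_derivative A (y s) + d s) (at s within {0..T})"
      and t: "t \<in> {0..T}"
    have int: "(\<lambda>s. norm (d s)) integrable_on {a..b}" if "{a..b} \<subseteq> {0..T}" for a b
      using continuous_on_subset[OF d that] by (intro integrable_continuous_interval continuous_intros)
    have le: "integral {0..t} (\<lambda>s. norm (d s)) \<le> integral {0..T} (\<lambda>s. norm (d s))"
      using t by (intro integral_subset_le int) auto
    have y_cont: "continuous_on {0..T} y"
      using y' by (rule continuous_on_vector_derivative)
    define g where "g s = S (t - s) (y s)" for s
    have "norm (g t - g 0) \<le> M * integral {0..t} (\<lambda>s. norm (d s))"
    proof (cases "t = 0")
      case False
      with t have "0 < t"
        by simp
      have "norm (g t - g 0) \<le> M * integral {0..t} (\<lambda>s. norm (d s)) - M * integral {0..0} (\<lambda>s. norm (d s))"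
      \<comment> \<open>Mean value inequality with the majorant
        \<open>M * integral {0..s} (\<lambda>s. norm (d s))\<close>. Derivatives are taken at
        interior times, where they are two-sided; at the end points continuity suffices.\<close>
      proof (rule differentiable_bound_general[OF \<open>0 < t\<close>])
        show "continuous_on {0..t} g"
          unfolding continuous_on_def
        proof
          fix s assume s: "s \<in> {0..t}"
          have "(y \<longlongrightarrow> y s) (at s within {0..t})"
            using continuous_on_subset[OF y_cont, of "{0..t}"] s t by (simp add: continuous_on_def)
          then show "(g \<longlongrightarrow> g s) (at s within {0..t})"
            unfolding g_def using s t
            by (intro tends tendsto_intros) (auto simp: eventually_at_filter)
        qed
        show "continuous_on {0..t} (\<lambda>s. M * integral {0..s} (\<lambda>s. norm (d s)))"
          using t by (intro continuous_intros indefinite_integral_continuous_1 int) auto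
        fix s assume s: "0 < s" "s < t"
        then have sT: "s \<in> {0..T}" and at: "at s within {0..T} = at s"
          using t by (auto intro: at_within_Icc_at)
        have "((\<lambda>s. integral {0..s} (\<lambda>s. norm (d s))) has_vector_derivative norm (d s)) (at s)"
          using integral_has_vector_derivative[OF continuous_on_norm[OF d] sT] by (simp only: at)
        then show "((\<lambda>s. M * integral {0..s} (\<lambda>s. norm (d s))) has_vector_derivative M * norm (d s)) (at s)"
          by (rule has_vector_derivative_mult_right)
        show "norm (S (t - s) (d s)) \<le> M * norm (d s)"
          using s t by (intro bound) auto
        let ?y' = "A (y s) + d s"
        have y's: "(y has_vector_derivative ?y') (at s)"
          using y'[OF sT] by (simp only: at)
        note yr = y's[unfolded has_vector_derivative_iff_one_sided, THEN conjunct1]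
        note yl = y's[unfolded has_vector_derivative_iff_one_sided, THEN conjunct2]
        have h0: "((\<lambda>h. h) \<longlongrightarrow> 0) (at_right (0::real))"
          by (rule tendsto_ident_at)
        have ev: "\<forall>\<^sub>F h in at_right (0::real). 0 < h \<and> h < min s (t - s)"
          using s by (intro eventually_at_rightI[of 0 "min s (t - s)"]) auto
        show "(g has_vector_derivative S (t - s) (d s)) (at s)"
          unfolding has_vector_derivative_iff_one_sided
        proof
          \<comment> \<open>Since \<open>g s = S (t - (s + h)) (S h (y s))\<close>, the right
            quotient of \<open>g\<close> is \<open>S (t - (s + h))\<close> applied to the quotient
            of \<open>y\<close> minus the generator quotient at \<open>y s\<close>.\<close>
          have "((\<lambda>h. S (t - (s + h)) ((1 / h) *\<^sub>R (y (s + h) - y s) - (1 / h) *\<^sub>R (S h (y s) - y s)))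
              \<longlongrightarrow> S (t - (s + 0)) (?y' - A (y s))) (at_right 0)"
          proof (rule tends)
            show "\<forall>\<^sub>F h in at_right 0. t - (s + h) \<in> {0..T}"
              using ev by eventually_elim (use s t in auto)
            show "((\<lambda>h. t - (s + h)) \<longlongrightarrow> t - (s + 0)) (at_right 0)"
              by (intro tendsto_intros)
            show "((\<lambda>h. (1 / h) *\<^sub>R (y (s + h) - y s) - (1 / h) *\<^sub>R (S h (y s) - y s))
              \<longlongrightarrow> ?y' - A (y s)) (at_right 0)"
              by (intro tendsto_diff yr gen D sT)
            show "t - (s + 0) \<in> {0..T}"
              using s t by simp
          qed
          then have "((\<lambda>h. S (t - (s + h)) ((1 / h) *\<^sub>R (y (s + h) - y s) - (1 / h) *\<^sub>R (S h (y s) - y s)))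
              \<longlongrightarrow> S (t - s) (d s)) (at_right 0)"
            by simp
          then show "((\<lambda>h. (1 / h) *\<^sub>R (g (s + h) - g s)) \<longlongrightarrow> S (t - s) (d s)) (at_right 0)"
          proof (rule Lim_transform_eventually)
            show "\<forall>\<^sub>F h in at_right 0. S (t - (s + h)) ((1 / h) *\<^sub>R (y (s + h) - y s) - (1 / h) *\<^sub>R (S h (y s) - y s))
              = (1 / h) *\<^sub>R (g (s + h) - g s)"
              using ev
            proof eventually_elim
              case (elim h)
              then have "g s = S (t - (s + h)) (S h (y s))"
                using C0_semigroupD(3)[OF S, of "t - (s + h)" h "y s"] by (simp add: g_def)
              moreover have "linear (S (t - (s + h)))"
                using elim by (intro lin) auto
              ultimately show ?case
                by (simp add: g_def linear_diff linear_scale scaleR_diff_right)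
            qed
          qed
          define q where "q h = (1 / h) *\<^sub>R (y s - y (s - h))" for h
          have q: "(q \<longlongrightarrow> ?y') (at_right 0)"
            unfolding q_def by (rule yl)
          have "((\<lambda>h. S h (q h)) \<longlongrightarrow> S 0 ?y') (at_right 0)"
          proof (rule tends[OF h0 _ _ q])
            show "\<forall>\<^sub>F h in at_right 0. h \<in> {0..T}"
              using ev by eventually_elim (use s t in auto)
          qed (use s t in auto)
          then have "((\<lambda>h. S h (q h)) \<longlongrightarrow> ?y') (at_right 0)"
            using C0_semigroupD(2)[OF S] by simp
          \<comment> \<open>Substituting \<open>y (s - h) = y s - h *\<^sub>R q h\<close> puts the
            generator quotient at the fixed vector \<open>y s\<close>. The added and subtracted
            \<open>q h\<close> cancel, leaving \<open>S h (q h)\<close> minus that quotient.\<close>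
          then have "((\<lambda>h. S (t - s) (q h - ((1 / h) *\<^sub>R (S h (y s) - y s) - S h (q h) + q h)))
              \<longlongrightarrow> S (t - s) (?y' - (A (y s) - ?y' + ?y'))) (at_right 0)"
            using s t by (intro tends tendsto_const tendsto_diff tendsto_add q gen D) auto
          then have "((\<lambda>h. S (t - s) (q h - ((1 / h) *\<^sub>R (S h (y s) - y s) - S h (q h) + q h)))
              \<longlongrightarrow> S (t - s) (d s)) (at_right 0)"
            by simp
          then show "((\<lambda>h. (1 / h) *\<^sub>R (g s - g (s - h))) \<longlongrightarrow> S (t - s) (d s)) (at_right 0)"
          proof (rule Lim_transform_eventually)
            show "\<forall>\<^sub>F h in at_right 0. S (t - s) (q h - ((1 / h) *\<^sub>R (S h (y s) - y s) - S h (q h) + q h))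
              = (1 / h) *\<^sub>R (g s - g (s - h))"
              using ev
            proof eventually_elim
              case (elim h)
              have "g (s - h) = S (t - s) (S h (y (s - h)))"
                using elim s C0_semigroupD(3)[OF S, of "t - s" h "y (s - h)"]
                by (simp add: g_def algebra_simps)
              moreover have "linear (S (t - s))" "linear (S h)"
                using elim s by (auto intro!: lin)
              ultimately show ?case
                by (simp add: g_def q_def linear_diff linear_add linear_scale scaleR_diff_right)
            qed
          qed
        qed
      qed
      then show ?thesis
        by simp
    qed simp
    also have "\<dots> \<le> M * integral {0..T} (\<lambda>s. norm (d s))"
      using M le by (intro mult_left_mono) auto
    finally have "norm (g t - g 0) \<le> M * integral {0..T} (\<lambda>s. norm (d s))" .
    moreover have "g t = y t" "norm (g 0) \<le> M * norm (y 0)"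
      using C0_semigroupD(2)[OF S] bound t by (simp_all add: g_def)
    ultimately show "norm (y t) \<le> M * (norm (y 0) + integral {0..T} (\<lambda>s. norm (d s)))"
      using norm_triangle_sub[of "g t" "g 0"] by (simp add: algebra_simps)
  qed
qed

subsection \<open>Upper bounds\<close>

text \<open>The equation gives \<open>N^k y = (N^(k+1) y)' - N^k d\<close>. Starting from
  \<open>N^p y = 0\<close>, each step lowers the power of \<open>N\<close> by one and costs one
  derivative of \<open>d\<close>. The last step reaches order \<open>p - 1\<close>, matching the
  assumed regularity.\<close>

lemma nilpotent_solution:
  fixes N :: "'a::real_normed_vector \<Rightarrow> 'a"
  assumes T: "T > 0" and N: "bounded_linear N" "\<And>z. (N ^^ p) z = 0" and d: "C_k T (p - 1) d"
    and sol: "\<And>t. t \<in> {0..T} \<Longrightarrow> ((\<lambda>s. N (y s)) has_vector_derivative y t + d t) (at t within {0..T})"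
    and "t \<in> {0..T}"
  shows "y t = - (\<Sum>i<p. (N ^^ i) (nth_deriv T i d t))"
proof -
  have "(N ^^ (p - j)) (y t) = - (\<Sum>i<j. (N ^^ (p - j + i)) (nth_deriv T i d t))"
    if "j \<le> p" "t \<in> {0..T}" for j t
    using that
  proof (induction j arbitrary: t)
    case 0
    then show ?case
      by (simp add: N(2))
  next
    case (Suc j)
    define k where "k = p - Suc j"
    have k: "p - j = Suc k"
      using Suc.prems by (simp add: k_def)
    let ?F = "\<lambda>s. (N ^^ k) (N (y s))"
    have IH: "?F s = - (\<Sum>i<j. (N ^^ (Suc k + i)) (nth_deriv T i d s))" if "s \<in> {0..T}" for s
      using Suc.IH[OF _ that] Suc.prems unfolding k by (simp add: funpow_swap1)
    have "(?F has_vector_derivative (N ^^ k) (y t + d t)) (at t within {0..T})"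
      by (rule bounded_linear.has_vector_derivative[OF bounded_linear_funpow[OF N(1)] sol[OF Suc.prems(2)]])
    moreover have "(?F has_vector_derivative - (\<Sum>i<j. (N ^^ (Suc k + i)) (nth_deriv T (Suc i) d t)))
        (at t within {0..T})"
    proof (rule has_vector_derivative_transform[OF Suc.prems(2) IH])
      show "((\<lambda>s. - (\<Sum>i<j. (N ^^ (Suc k + i)) (nth_deriv T i d s))) has_vector_derivative
          - (\<Sum>i<j. (N ^^ (Suc k + i)) (nth_deriv T (Suc i) d t))) (at t within {0..T})"
        using Suc.prems
        by (intro has_vector_derivative_minus has_vector_derivative_sum
            bounded_linear.has_vector_derivative[OF bounded_linear_funpow[OF N(1)]]
            nth_deriv_has_vector_derivative[OF d]) auto
    qed
    \<comment> \<open>The same function was differentiated once by the equation and once by the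
      induction hypothesis; uniqueness equates the results.\<close>
    ultimately have "(N ^^ k) (y t + d t) = - (\<Sum>i<j. (N ^^ (Suc k + i)) (nth_deriv T (Suc i) d t))"
      using vector_derivative_within_Icc[OF T Suc.prems(2)] by metis
    then have "(N ^^ k) (y t) = - (N ^^ k) (d t) - (\<Sum>i<j. (N ^^ (Suc k + i)) (nth_deriv T (Suc i) d t))"
      by (simp add: linear_add[OF bounded_linear.linear[OF bounded_linear_funpow[OF N(1)]]]
          algebra_simps eq_neg_iff_add_eq_0)
    then show ?case
      \<comment> \<open>The new term \<open>(N ^^ k) (d t)\<close> becomes the summand
        \<open>i = 0\<close>, and the old summands shift up by one.\<close>
      unfolding k_def[symmetric] by (subst sum.lessThan_Suc_shift) simp
  qed
  from this[of p t] assms(6) show ?thesis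
    by simp
qed

lemma perturbation_estimate_semigroup:
  fixes A1 :: "'y1::cbanach \<Rightarrow> 'y1"
  assumes T: "T > 0" and gen: "generates_C0_semigroup D1 A1"
  shows "perturbation_estimate T (\<lambda>y. y) D1 A1 0"
proof -
  obtain M where M: "M > 0" and
    bound: "\<And>y d t. continuous_on {0..T} d \<Longrightarrow> (\<And>s. s \<in> {0..T} \<Longrightarrow> y s \<in> D1) \<Longrightarrow>
    (\<And>s. s \<in> {0..T} \<Longrightarrow> (y has_vector_derivative A1 (y s) + d s) (at s within {0..T})) \<Longrightarrow> t \<in> {0..T} \<Longrightarrow>
    norm (y t) \<le> M * (norm (y 0) + integral {0..T} (\<lambda>s. norm (d s)))"
    using generates_C0_semigroup_estimate[OF gen] by blast
  show ?thesis
    unfolding perturbation_estimate_def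
    using M by (intro exI[of _ M]) (auto simp: classical_solution_def C_k_def intro!: bound)
qed

text \<open>The components decouple: the semigroup estimate bounds the first, and the explicit
  formula bounds the second. For \<open>p = 0\<close> the hypothesis on \<open>N\<close> makes the
  second space trivial and the formula an empty sum.\<close>

lemma perturbation_estimate_weierstrass:
  fixes A1 :: "'y1::cbanach \<Rightarrow> 'y1" and N :: "'y2::cbanach \<Rightarrow> 'y2"
  assumes T: "T > 0" and gen: "generates_C0_semigroup D1 A1"
    and N: "bounded_linear N" "\<And>z. (N ^^ p) z = 0"
  shows "perturbation_estimate T (\<lambda>(y1, y2). (y1, N y2)) (D1 \<times> UNIV) (\<lambda>(y1, y2). (A1 y1, y2)) p"
proof -
  obtain M where M: "M > 0" and
    bound: "\<And>y d t. continuous_on {0..T} d \<Longrightarrow> (\<And>s. s \<in> {0..T} \<Longrightarrow> y s \<in> D1) \<Longrightarrow>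
    (\<And>s. s \<in> {0..T} \<Longrightarrow> (y has_vector_derivative A1 (y s) + d s) (at s within {0..T})) \<Longrightarrow> t \<in> {0..T} \<Longrightarrow>
    norm (y t) \<le> M * (norm (y 0) + integral {0..T} (\<lambda>s. norm (d s)))"
    using generates_C0_semigroup_estimate[OF gen] by blast
  define K where "K = (\<Sum>i<p. onorm (N ^^ i))"
  have K: "K \<ge> 0"
    unfolding K_def by (intro sum_nonneg onorm_pos_le bounded_linear_funpow N)
  show ?thesis
    unfolding perturbation_estimate_alt
  \<comment> \<open>\<open>M * (1 + T)\<close> covers the initial value and the integral of the
    perturbation, and \<open>K\<close> covers the derivatives in the nilpotent block.\<close>
  proof (intro exI[of _ "M * (1 + T) + K"] conjI allI impI ballI)
    show "M * (1 + T) + K > 0"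
      using M T K by (simp add: add_pos_nonneg)
    fix x :: "real \<Rightarrow> 'y1 \<times> 'y2" and \<delta> t
    assume C: "C_k T (p - 1) \<delta>" and t: "t \<in> {0..T}"
      and sol: "classical_solution T (\<lambda>(y1, y2). (y1, N y2)) (D1 \<times> UNIV) (\<lambda>(y1, y2). (A1 y1, y2)) \<delta> x"
    let ?R = "perturbation_size T p \<delta>"
    have cont: "continuous_on {0..T} \<delta>"
      using nth_deriv_continuous_on[OF C, of 0] by simp
    have D1: "fst (x s) \<in> D1" if "s \<in> {0..T}" for s
      using sol that by (auto simp: classical_solution_def mem_Times_iff)
    have deriv: "((\<lambda>s. (fst (x s), N (snd (x s)))) has_vector_derivative
        (A1 (fst (x s)) + fst (\<delta> s), snd (x s) + snd (\<delta> s))) (at s within {0..T})"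
      if "s \<in> {0..T}" for s
      using sol that by (simp add: classical_solution_def case_prod_unfold plus_prod_def)
    have "norm (fst (x t)) \<le> M * (norm (fst (x 0)) + integral {0..T} (\<lambda>s. norm (fst (\<delta> s))))"
    proof (rule bound[where y = "\<lambda>s. fst (x s)", OF continuous_on_fst[OF cont] D1 _ t])
      fix s assume "s \<in> {0..T}"
      from bounded_linear.has_vector_derivative[OF bounded_linear_fst deriv[OF this]]
      show "((\<lambda>s. fst (x s)) has_vector_derivative A1 (fst (x s)) + fst (\<delta> s)) (at s within {0..T})"
        by simp
    qed
    also have "\<dots> \<le> M * (norm (x 0) + integral {0..T} (\<lambda>s. norm (\<delta> s)))"
    proof (intro mult_left_mono add_mono integral_le norm_integrable_on_Icc continuous_on_fst cont)
      show "norm (fst z) \<le> norm z" for z :: "'y1 \<times> 'y2"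
        by (metis norm_fst_le surjective_pairing)
      then show "norm (fst (\<delta> s)) \<le> norm (\<delta> s)" for s .
    qed (use M in auto)
    also have "\<dots> \<le> M * (norm (x 0) + (1 + T) * ?R)"
      using M integral_norm_le_perturbation_size(1)[OF T C] by (intro mult_left_mono add_left_mono) auto
    finally have 1: "norm (fst (x t)) \<le> M * (norm (x 0) + (1 + T) * ?R)" .
    have "snd (x t) = - (\<Sum>i<p. (N ^^ i) (nth_deriv T i (\<lambda>s. snd (\<delta> s)) t))"
    proof (rule nilpotent_solution[OF T N _ _ t])
      show "C_k T (p - 1) (\<lambda>s. snd (\<delta> s))"
        by (rule C_k_bounded_linear[OF T bounded_linear_snd C])
      fix s assume "s \<in> {0..T}"
      from bounded_linear.has_vector_derivative[OF bounded_linear_snd deriv[OF this]]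
      show "((\<lambda>s. N (snd (x s))) has_vector_derivative snd (x s) + snd (\<delta> s)) (at s within {0..T})"
        by simp
    qed
    then have "norm (snd (x t)) \<le> (\<Sum>i<p. norm ((N ^^ i) (nth_deriv T i (\<lambda>s. snd (\<delta> s)) t)))"
      by (simp add: norm_sum)
    also have "\<dots> \<le> (\<Sum>i<p. onorm (N ^^ i) * ?R)"
    proof (rule sum_mono)
      fix i assume i: "i \<in> {..<p}"
      have "nth_deriv T i (\<lambda>s. snd (\<delta> s)) t = snd (nth_deriv T i \<delta> t)"
        using i by (intro nth_deriv_bounded_linear[OF T bounded_linear_snd C _ t]) auto
      moreover have "norm (snd (nth_deriv T i \<delta> t)) \<le> norm (nth_deriv T i \<delta> t)"
        by (metis norm_snd_le surjective_pairing)
      ultimately have "norm (nth_deriv T i (\<lambda>s. snd (\<delta> s)) t) \<le> ?R"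
        using norm_nth_deriv_le_perturbation_size[OF C _ t, of i] i by simp
      then have "onorm (N ^^ i) * norm (nth_deriv T i (\<lambda>s. snd (\<delta> s)) t) \<le> onorm (N ^^ i) * ?R"
        by (intro mult_left_mono onorm_pos_le bounded_linear_funpow N)
      then show "norm ((N ^^ i) (nth_deriv T i (\<lambda>s. snd (\<delta> s)) t)) \<le> onorm (N ^^ i) * ?R"
        using onorm[OF bounded_linear_funpow[OF N(1)]] order_trans by blast
    qed
    finally have 2: "norm (snd (x t)) \<le> K * ?R"
      by (simp add: K_def sum_distrib_right)
    have "norm (x t) \<le> norm (fst (x t)) + norm (snd (x t))"
      by (metis norm_Pair_le surjective_pairing)
    also have "\<dots> \<le> M * (norm (x 0) + (1 + T) * ?R) + K * ?R"
      using 1 2 by simp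
    also have "\<dots> \<le> (M * (1 + T) + K) * (norm (x 0) + ?R)"
      using M T K integral_norm_le_perturbation_size(2)[OF T C] by (simp add: algebra_simps)
    finally show "norm (x t) \<le> (M * (1 + T) + K) * (norm (x 0) + ?R)" .
  qed
qed

lemma weierstrass_index_perturbation_estimate:
  fixes E :: "'x::complex_normed_vector \<Rightarrow> 'z::complex_normed_vector"
    and D1 :: "'y1::chilbert_space set"
  assumes T: "T > 0" and ind: "weierstrass_index TYPE('y2::chilbert_space) E D A D1 A1 p"
    and gen: "generates_C0_semigroup D1 A1"
  shows "perturbation_estimate T E D A p"
proof -
  from ind consider N :: "'y2 \<Rightarrow> 'y2" where "weierstrass_form E D A D1 A1 N" "nilpotency_degree N p"
    | "p = 0" "equivalent_pairs E D A (\<lambda>y. y) D1 A1"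
    unfolding weierstrass_index_def by blast
  then show ?thesis
  proof cases
    case 1
    then have equiv: "equivalent_pairs E D A (\<lambda>(y1, y2). (y1, N y2)) (D1 \<times> UNIV) (\<lambda>(y1, y2). (A1 y1, y2))"
      and N: "bounded_linear N" "\<And>z. (N ^^ p) z = 0"
      by (simp_all add: weierstrass_form_def bounded_clinear_def nilpotency_degree_def)
    show ?thesis
      by (rule perturbation_estimate_equivalent[OF T equiv perturbation_estimate_weierstrass[OF T gen N]])
  next
    case 2
    show ?thesis
      unfolding 2(1)
      by (rule perturbation_estimate_equivalent[OF T 2(2) perturbation_estimate_semigroup[OF T gen]])
  qed
qed

section \<open>Comparison of the two indices\<close>

theorem proposition8p3:
  fixes E :: "'x::cbanach \<Rightarrow> 'z::cbanach"
    and D :: "'x set" and A :: "'x \<Rightarrow> 'z"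
    and T :: real
  assumes "bounded_clinear E"
    and "linear_operator D A"
    and "closed_operator D A"
    and "densely_defined D"
    and "resolvent_set E D A \<noteq> {}"
    and "T > 0"
  shows "(\<forall>p q. has_nilpotency_index TYPE('y1::chilbert_space) TYPE('y2::chilbert_space) E D A p \<longrightarrow>
            has_perturbation_index T E D A q \<longrightarrow> p \<le> q) \<and>
         (\<forall>p (D1 :: 'y1 set) A1. weierstrass_index TYPE('y2) E D A D1 A1 p \<longrightarrow>
            generates_C0_semigroup D1 A1 \<longrightarrow>
            (\<exists>q. has_perturbation_index T E D A q \<and> p = q))"
proof (intro conjI allI impI)
  fix p q
  assume "has_nilpotency_index TYPE('y1) TYPE('y2) E D A p" "has_perturbation_index T E D A q"
  then show "p \<le> q"
    unfolding has_nilpotency_index_def has_perturbation_index_def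
    using weierstrass_index_le_perturbation_index[OF \<open>T > 0\<close>] by blast
next
  fix p and D1 :: "'y1 set" and A1
  assume ind: "weierstrass_index TYPE('y2) E D A D1 A1 p" and gen: "generates_C0_semigroup D1 A1"
  \<comment> \<open>The lower bound rules out every order below \<open>p\<close>. With the upper
    bound at order \<open>p\<close> itself, \<open>p\<close> is the smallest admissible
    order.\<close>
  have "\<not> perturbation_estimate T E D A q" if "q < p" for q
    using weierstrass_index_le_perturbation_index[OF \<open>T > 0\<close> ind] that not_less by blast
  then show "\<exists>q. has_perturbation_index T E D A q \<and> p = q"
    using weierstrass_index_perturbation_estimate[OF \<open>T > 0\<close> ind gen]
    by (simp add: has_perturbation_index_def)
qed

end
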